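(* For each $a\in\mathcal{A}$ there exists a sequence of parameters $\{a_n\}_{n=1}^{\infty}\subset(0,2]$ such that each $f_{a_n}$ has a super-stable periodic attractor of length $r_n$, and such that (i) $a_n\to a$ as $n\to\infty$; (ii) $r_n\uparrow\infty$ as $n\to\infty$; (iii) if $x=0$ is generic for $\mu_a$, then $\mu_{a_n}\to\mu_a$ in the weak* topology as $n\to\infty$.
   Context: The quadratic family is $f_a(x)=1-ax^2$, $0<a\le 2$, acting on $I=[-1,1]$; its critical point is $0$. A periodic orbit of $f_a$ is super-stable (a super-attractor) if it contains the critical point $0$; its length is its (prime) period. An acip of $f_a$ is an absolutely continuous (with respect to Lebesgue measure) invariant probability measure. A point $x$ is generic for an invariant probability measure $\mu$ of $f_a$ if $\frac1n\sum_{k=0}^{n-1}\delta_{f_a^k(x)}\to\mu$ in the weak* topology. If $f_a$ admits an acip, $\mu_a$ denotes that acip; if $f_a$ has a periodic attractor $\{x_1,\dots,x_p\}$, then $\mu_a=\frac1p\sum_{i=1}^p\delta_{x_i}$. In either case $\mu_a$ is the natural measure of $f_a$, i.e. it describes the asymptotic distribution of the orbits of Lebesgue almost all $x\in I$. The set $\mathcal{A}\subset(0,2]$ is the positive-measure set of parameters constructed by Benedicks and Carleson (On iterations of $1-ax^2$, Ann. of Math. 1985; The dynamics of the Hénon map, Ann. of Math. 1991). It has $2$ as a Lebesgue density point, and for every $a\in\mathcal{A}$ the Lyapunov exponent of $f_a$ at the critical value is positive and $f_a$ admits an acip $\mu_a$ with density in $L^p$ for all $1\le p<2$. The structure of the construction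 is as follows. Constants $\lambda>0$, $\alpha>0$ (suitably small), $\delta>0$ (sufficiently small) are fixed, and everything takes place in a sufficiently small one-sided parameter neighborhood of $2$. Put $I^*=(-\delta,\delta)$; for integers $\mu$ with $|\mu|\ge-\log\delta$ let $I_\mu=[e^{-(\mu+1)},e^{-\mu})$ if $\mu>0$ and $I_\mu=-I_{-\mu}$ if $\mu<0$; subdivide $I_\mu$ into $\mu^2$ intervals $I_{\mu\nu}$, $1\le\nu\le\mu^2$, of equal length, and let $I_{\mu\nu}^+$ be the union of $I_{\mu\nu}$ and its two nearest neighbors. Let $\xi_n(a)=f_a^n(0)$. Then $\mathcal{A}=\bigcap_{n\ge0}A_n$ for a decreasing sequence of sets $A_n$, where every $a\in A_n$ satisfies $|Df_a^j(f_a(0))|\ge e^{\lambda j}$ for all $j\le n$ and $|f_a^j(0)|\ge e^{-\alpha j}$ for all $1\le j\le n$. Each $A_n$ carries a partition $\mathcal{P}_n$ into intervals; $\omega_n(a)$ is the element of $\mathcal{P}_n$ containing $a$, the $\omega_n(a)$ are nested, and $\{a\}=\bigcap_n\omega_n(a)$ for $a\in\mathcal{A}$. Each $a\in\mathcal{A}$ has an infinite increasing sequence $n_k=n_k(a)$ of essential free return times such that, with $\omega_n=\omega_n(a)$: $\omega_n=\omega_{n_k}$ for $n_k\le n<n_{k+1}$; if $n\le n_k$ and $\xi_n(\omega_{n_k})\cap I^*\ne\emptyset$ then $\xi_n(\omega_{n_k})\subset$ some $I_{\mu\nu}^+$; and $I_{\mu\nu}\subset\xi_{n_k}(\omega_{n_k})\subset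 I_{\mu\nu}^+$ for some $I_{\mu\nu}$. After a free return of a parameter interval $\omega$ at time $n$ with $\xi_n(\omega)\subset I_{\mu\nu}^+$, there follows a bound period lasting as long as $\left|\bigcup_{b\in\omega}f_b^j(-e^{-|\mu|},e^{-|\mu|})\right|\le e^{-2\alpha j}$. If $p_k$ is the length of the bound period after $n_k$, then $n_{k+1}$ is the smallest $j\ge n_k+p_k$ such that $\xi_j(\omega_{n_k})$ contains some $I_{\mu\nu}\subset I^*$; returns to $I^*$ at times $j$ with $n_k+p_k\le j<n_{k+1}$ at which no $I_{\mu\nu}$ is covered are called inessential free returns and are also followed by bound periods. An essential free return time $n_k$ is an escape-time of $a$ if $\xi_{n_k}(\omega_{n_k-1})$ intersects $(-\delta^2,\delta^2)$ and $|\xi_{n_k}(\omega_{n_k-1})|\ge\delta$. Besides the exclusion of parameters violating $|f_a^n(0)|\ge e^{-\alpha n}$, a second exclusion rule discards parameters that on average wait too long for escape-times; in particular each $a\in\mathcal{A}$ has infinitely many escape-times. *)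

theory Defs
  imports "HOL-Probability.Probability"
begin

definition quad :: "real \<Rightarrow> real \<Rightarrow> real" where
  "quad a x = 1 - a * x\<^sup>2"

subsection \<open>Super-stable periodic orbits\<close>

definition prime_period :: "('a \<Rightarrow> 'a) \<Rightarrow> 'a \<Rightarrow> nat \<Rightarrow> bool" where
  "prime_period g x p \<longleftrightarrow>
     0 < p \<and> (g ^^ p) x = x \<and> (\<forall>q. 0 < q \<and> q < p \<longrightarrow> (g ^^ q) x \<noteq> x)"

definition periodic_orbit :: "real \<Rightarrow> nat \<Rightarrow> real set \<Rightarrow> bool" where
  "periodic_orbit a p S \<longleftrightarrow>
     (\<exists>x\<in>{-1..1}. prime_period (quad a) x p \<and> S = (\<lambda>k. (quad a ^^ k) x) ` {..<p})"

definition super_stable :: "real \<Rightarrow> nat \<Rightarrow> real set \<Rightarrow> bool" where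
  "super_stable a p S \<longleftrightarrow> periodic_orbit a p S \<and> 0 \<in> S"

subsection \<open>Invariant measures and weak* convergence on I = [-1,1]\<close>

definition leb_I :: "real measure" where
  "leb_I = restrict_space lborel {-1..1}"

definition acip :: "real \<Rightarrow> real measure \<Rightarrow> bool" where
  "acip a M \<longleftrightarrow> prob_space M \<and> sets M = sets leb_I \<and>
     distr M M (quad a) = M \<and> absolutely_continuous leb_I M"

definition weak_star_lim :: "(nat \<Rightarrow> real measure) \<Rightarrow> real measure \<Rightarrow> bool" where
  "weak_star_lim Ms M \<longleftrightarrow>
     (\<forall>\<phi>::real \<Rightarrow> real. continuous_on {-1..1} \<phi> \<longrightarrow>
        (\<lambda>n. \<integral>x. \<phi> x \<partial>Ms n) \<longlonglongrightarrow> (\<integral>x. \<phi> x \<partial>M))"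

text \<open>Averages of point masses are written as images of uniform distributions on finite sets:
  \<^term>\<open>empirical a x n\<close> is \<open>(1/n) \<Sum>k<n. \<delta>(f_a^k x)\<close>, and \<^term>\<open>orbit_measure S\<close>
  is \<open>(1/card S) \<Sum>x\<in>S. \<delta>(x)\<close>.\<close>

definition empirical :: "real \<Rightarrow> real \<Rightarrow> nat \<Rightarrow> real measure" where
  "empirical a x n = distr (uniform_count_measure {..<n}) leb_I (\<lambda>k. (quad a ^^ k) x)"

definition orbit_measure :: "real set \<Rightarrow> real measure" where
  "orbit_measure S = distr (uniform_count_measure S) leb_I (\<lambda>x. x)"

lemma integral_distr_uniform_count_measure:
  fixes \<phi> :: "real \<Rightarrow> real"
  assumes "finite J" "g ` J \<subseteq> {-1..1}" "continuous_on {-1..1} \<phi>"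
  shows "(\<integral>x. \<phi> x \<partial>distr (uniform_count_measure J) leb_I g) = (\<Sum>j\<in>J. \<phi> (g j)) / card J"
proof -
  have "g \<in> measurable (uniform_count_measure J) leb_I"
    using assms(2)
    by (auto simp: measurable_def leb_I_def space_restrict_space space_uniform_count_measure
        sets_uniform_count_measure)
  moreover have "\<phi> \<in> borel_measurable leb_I"
    using borel_measurable_continuous_on_restrict[OF assms(3)]
    by (simp add: leb_I_def cong: measurable_cong_sets sets_restrict_space_cong)
  ultimately have "(\<integral>x. \<phi> x \<partial>distr (uniform_count_measure J) leb_I g)
      = (\<integral>j. \<phi> (g j) \<partial>uniform_count_measure J)"
    by (rule integral_distr)
  also have "\<dots> = (\<Sum>j\<in>J. \<phi> (g j)) / card J"
    using assms(1)
    by (simp add: uniform_count_measure_def lebesgue_integral_point_measure_finite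
        sum_divide_distrib)
  finally show ?thesis .
qed

definition generic :: "real \<Rightarrow> real \<Rightarrow> real measure \<Rightarrow> bool" where
  "generic a x M \<longleftrightarrow> weak_star_lim (empirical a x) M"

subsection \<open>The partition of the critical neighbourhood\<close>

text \<open>For \<open>\<mu> > 0\<close> the interval \<open>[exp(-(\<mu>+1)), exp(-\<mu>))\<close> is cut into \<open>\<mu>\<^sup>2\<close> intervals of
  equal length, numbered \<open>\<nu> = 1, \<dots>, \<mu>\<^sup>2\<close>; negative \<open>\<mu>\<close> give the mirror images.\<close>

definition sub_interval_pos :: "int \<Rightarrow> int \<Rightarrow> real set" where
  "sub_interval_pos \<mu> \<nu> =
     (let l = exp (- (real_of_int \<mu> + 1)); h = (exp (- real_of_int \<mu>) - l) / (real_of_int \<mu>)\<^sup>2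
      in {l + (real_of_int \<nu> - 1) * h ..< l + real_of_int \<nu> * h})"

definition sub_interval :: "int \<Rightarrow> int \<Rightarrow> real set" where
  "sub_interval \<mu> \<nu> =
     (if 0 < \<mu> then sub_interval_pos \<mu> \<nu> else uminus ` sub_interval_pos (- \<mu>) \<nu>)"

text \<open>The two nearest neighbours are the members of the family that share an endpoint. They are
  taken in the family of all \<open>\<mu> \<noteq> 0\<close>, so that the outermost intervals inside \<open>(-\<delta>,\<delta>)\<close>
  have an outer neighbour as well.\<close>

definition sub_interval_plus :: "int \<Rightarrow> int \<Rightarrow> real set" where
  "sub_interval_plus \<mu> \<nu> =
     \<Union>{sub_interval \<mu>' \<nu>' | \<mu>' \<nu>'. \<mu>' \<noteq> 0 \<and> 1 \<le> \<nu>' \<and> \<nu>' \<le> \<mu>'\<^sup>2 \<and>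
         closure (sub_interval \<mu>' \<nu>') \<inter> closure (sub_interval \<mu> \<nu>) \<noteq> {}}"

definition sub_index :: "real \<Rightarrow> (int \<times> int) set" where
  "sub_index \<delta> = {(\<mu>, \<nu>). - ln \<delta> \<le> real_of_int \<bar>\<mu>\<bar> \<and> 1 \<le> \<nu> \<and> \<nu> \<le> \<mu>\<^sup>2}"

definition covers :: "real \<Rightarrow> real set \<Rightarrow> bool" where
  "covers \<delta> X \<longleftrightarrow> (\<exists>(\<mu>, \<nu>) \<in> sub_index \<delta>. sub_interval \<mu> \<nu> \<subseteq> X)"

subsection \<open>The Benedicks--Carleson parameter sets\<close>

definition \<xi> :: "nat \<Rightarrow> real \<Rightarrow> real" where
  "\<xi> n a = (quad a ^^ n) 0"

definition cell :: "real set set \<Rightarrow> real \<Rightarrow> real set" where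
  "cell Q a = (THE w. w \<in> Q \<and> a \<in> w)"

definition bound_at :: "real \<Rightarrow> real set \<Rightarrow> int \<Rightarrow> nat \<Rightarrow> bool" where
  "bound_at \<alpha> \<omega> \<mu> j \<longleftrightarrow>
     measure lborel (\<Union>b\<in>\<omega>. (quad b ^^ j) ` {- exp (- \<bar>real_of_int \<mu>\<bar>) <..< exp (- \<bar>real_of_int \<mu>\<bar>)})
       \<le> exp (- 2 * \<alpha> * real j)"

definition bound_period :: "real \<Rightarrow> real set \<Rightarrow> int \<Rightarrow> nat \<Rightarrow> bool" where
  "bound_period \<alpha> \<omega> \<mu> p \<longleftrightarrow> (\<forall>j<p. bound_at \<alpha> \<omega> \<mu> j) \<and> \<not> bound_at \<alpha> \<omega> \<mu> p"

text \<open>At an essential free return at time \<open>n\<close> a cell \<open>\<omega>\<close> of the new partition either has its image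
  comparable to one \<open>sub_interval\<close> \<open>\<mu> \<nu>\<close>, and a bound period of length \<open>p\<close> follows, or it is
  one of the pieces of the old cell that are mapped outside \<open>(-\<delta>,\<delta>)\<close>; no bound
  period follows in this case.\<close>

definition essential_piece :: "real \<Rightarrow> real \<Rightarrow> real set \<Rightarrow> nat \<Rightarrow> nat \<Rightarrow> bool" where
  "essential_piece \<alpha> \<delta> \<omega> n p \<longleftrightarrow>
     (\<exists>(\<mu>, \<nu>) \<in> sub_index \<delta>. sub_interval \<mu> \<nu> \<subseteq> \<xi> n ` \<omega> \<and>
         \<xi> n ` \<omega> \<subseteq> sub_interval_plus \<mu> \<nu> \<and> bound_period \<alpha> \<omega> \<mu> p) \<or>
     (\<xi> n ` \<omega> \<inter> {-\<delta><..<\<delta>} = {} \<and> p = 0)"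

definition next_return :: "real \<Rightarrow> real set \<Rightarrow> nat \<Rightarrow> nat \<Rightarrow> bool" where
  "next_return \<delta> \<omega> m n \<longleftrightarrow>
     m \<le> n \<and> covers \<delta> (\<xi> n ` \<omega>) \<and> (\<forall>j. m \<le> j \<and> j < n \<longrightarrow> \<not> covers \<delta> (\<xi> j ` \<omega>))"

definition escape_time :: "real \<Rightarrow> (nat \<Rightarrow> real set) \<Rightarrow> nat \<Rightarrow> bool" where
  "escape_time \<delta> \<omega> n \<longleftrightarrow>
     \<xi> n ` \<omega> (n - 1) \<inter> {-\<delta>\<^sup>2<..<\<delta>\<^sup>2} \<noteq> {} \<and> \<delta> \<le> measure lborel (\<xi> n ` \<omega> (n - 1))"

text \<open>\<open>A n\<close> is the set of parameters surviving at step \<open>n\<close>, \<open>P n\<close> its partition into intervals,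
  and \<open>ret a k\<close> is the \<open>k\<close>-th essential free return time of \<open>a\<close> (counted from \<open>k = 0\<close>).
  The control of \<open>returns\<close> starts at time 1 because \<open>\<xi> 0\<close> is constantly 0. All parameters lie
  to the left of 2, whence the one-sided density in \<open>density_point\<close>.\<close>

locale benedicks_carleson =
  fixes \<Lambda> \<alpha> \<delta> a\<^sub>0 :: real
    and A :: "nat \<Rightarrow> real set"
    and P :: "nat \<Rightarrow> real set set"
    and ret :: "real \<Rightarrow> nat \<Rightarrow> nat"
  assumes nbhd: "A n \<subseteq> {a\<^sub>0..2}"
    and decreasing: "decseq A"
    and density_point: "(\<Inter>n. A n) \<in> sets lebesgue"
      "((\<lambda>\<epsilon>. measure lebesgue ((\<Inter>n. A n) \<inter> {2 - \<epsilon>..2}) / \<epsilon>) \<longlongrightarrow> 1) (at_right 0)"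
    and growth: "\<lbrakk>a \<in> A n; j \<le> n\<rbrakk> \<Longrightarrow> exp (\<Lambda> * real j) \<le> \<bar>deriv (quad a ^^ j) (quad a 0)\<bar>"
    and slow_recurrence: "\<lbrakk>a \<in> A n; 1 \<le> j; j \<le> n\<rbrakk> \<Longrightarrow> exp (- \<alpha> * real j) \<le> \<bar>(quad a ^^ j) 0\<bar>"
    and has_acip: "a \<in> (\<Inter>n. A n) \<Longrightarrow>
      \<exists>h \<in> borel_measurable leb_I. (\<forall>x. 0 \<le> h x) \<and> acip a (density leb_I (\<lambda>x. ennreal (h x))) \<and>
        (\<forall>p. 1 \<le> p \<and> p < 2 \<longrightarrow> integrable leb_I (\<lambda>x. h x powr p))"
    and partition: "partition_on (A n) (P n)"
    and intervals: "\<omega> \<in> P n \<Longrightarrow> is_interval \<omega>"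
    and nested: "\<lbrakk>a \<in> A n; m \<le> n\<rbrakk> \<Longrightarrow> cell (P n) a \<subseteq> cell (P m) a"
    and shrinking: "a \<in> (\<Inter>n. A n) \<Longrightarrow> (\<Inter>n. cell (P n) a) = {a}"
    and ret_increasing: "a \<in> (\<Inter>n. A n) \<Longrightarrow> strict_mono (ret a)"
    and cell_constant: "\<lbrakk>a \<in> (\<Inter>n. A n); ret a k \<le> n; n < ret a (Suc k)\<rbrakk> \<Longrightarrow>
      cell (P n) a = cell (P (ret a k)) a"
    and returns: "\<lbrakk>a \<in> (\<Inter>n. A n); 1 \<le> n; n \<le> ret a k;
        \<xi> n ` cell (P (ret a k)) a \<inter> {-\<delta><..<\<delta>} \<noteq> {}\<rbrakk> \<Longrightarrow>
      \<exists>(\<mu>, \<nu>) \<in> sub_index \<delta>. \<xi> n ` cell (P (ret a k)) a \<subseteq> sub_interval_plus \<mu> \<nu>"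
    and essential: "a \<in> (\<Inter>n. A n) \<Longrightarrow> covers \<delta> (\<xi> (ret a k) ` cell (P (ret a k - 1)) a)"
    and next_essential: "a \<in> (\<Inter>n. A n) \<Longrightarrow>
      \<exists>p. essential_piece \<alpha> \<delta> (cell (P (ret a k)) a) (ret a k) p \<and>
          next_return \<delta> (cell (P (ret a k)) a) (ret a k + p) (ret a (Suc k))"
    and infinitely_many_escapes: "a \<in> (\<Inter>n. A n) \<Longrightarrow>
      infinite {k. escape_time \<delta> (\<lambda>n. cell (P n) a) (ret a k)}"

end

(*
  The argument is topological. A homterval of f = f_a is a nondegenerate interval none of whose
  images has 0 in its interior. For a close to 2 with expansion along the critical orbit and slow
  recurrence, the images of a homterval are expanded, both while they stay away from 0 and, by
  binding to the critical orbit, after they pass near 0; so each homterval reaches a definite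
  length again and again. Two long images overlap, which yields a monotone self-map of an interval
  under some iterate of f and hence homtervals all of whose images are short: f has no homtervals.

  By compactness it follows that, for parameters b, b' near a, points whose itineraries agree for
  N steps are close to each other. Applied to the long images of the shrinking parameter cells at
  escape times, this shows that a is a limit of zeros of the maps b |-> f_b^j(0). The zero closest
  to a on a segment starting at a is a super-stable parameter of some period r, and its critical
  orbit has the itinerary of the critical orbit of a up to time r. Hence the two orbits are close
  up to time r - N, and the uniform measure on the super-attractor is close to the empirical
  measure of 0 under f_a at time r.
*)
theory Submission
  imports Defs
begin

subsection \<open>Expansion of intervals away from the critical point\<close>

lemma funpow_quad_Suc: "(quad a ^^ Suc n) x = quad a ((quad a ^^ n) x)"
  by simp

lemma quad_in_I:
  assumes "0 < a" "a \<le> 2" "x \<in> {-1..1}"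
  shows "quad a x \<in> {-1..1}"
proof -
  have "x\<^sup>2 \<le> 1" using assms(3) by (auto simp: abs_square_le_1)
  then have "a * x\<^sup>2 \<le> 2 * 1" using assms by (intro mult_mono) auto
  moreover have "0 \<le> a * x\<^sup>2" using assms by simp
  ultimately show ?thesis by (simp add: quad_def)
qed

lemma funpow_quad_in_I:
  assumes "0 < a" "a \<le> 2" "x \<in> {-1..1}"
  shows "(quad a ^^ n) x \<in> {-1..1}"
  by (induction n) (use assms quad_in_I in auto)

section \<open>Exact growth of the distance between two orbits\<close>

lemma quad_diff: "quad a x - quad a y = - (a * (x + y) * (x - y))"
  by (simp add: quad_def power2_eq_square algebra_simps)

text \<open>By \<open>quad_diff\<close> this is, for \<open>a \<ge> 0\<close>, exactly the factor by
  which the \<open>n\<close>-th iterate multiplies the distance of \<open>x\<close> and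
  \<open>y\<close>. It takes the place of derivative and distortion estimates on the interval
  between them.\<close>

definition stretch :: "real \<Rightarrow> real \<Rightarrow> real \<Rightarrow> nat \<Rightarrow> real" where
  "stretch a x y n = (\<Prod>i<n. a * \<bar>(quad a ^^ i) x + (quad a ^^ i) y\<bar>)"

lemma stretch_0 [simp]: "stretch a x y 0 = 1"
  by (simp add: stretch_def)

lemma stretch_Suc: "stretch a x y (Suc n) = stretch a x y n * (a * \<bar>(quad a ^^ n) x + (quad a ^^ n) y\<bar>)"
  by (simp add: stretch_def)

lemma stretch_add: "stretch a x y (m + n) = stretch a x y m * stretch a ((quad a ^^ m) x) ((quad a ^^ m) y) n"
proof (induction n)
  case (Suc n)
  have "(quad a ^^ (m + n)) z = (quad a ^^ n) ((quad a ^^ m) z)" for z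
    by (metis add.commute funpow_add o_apply)
  then show ?case using Suc by (simp add: stretch_Suc)
qed simp

lemma stretch_nonneg: "0 \<le> a \<Longrightarrow> 0 \<le> stretch a x y n"
  by (auto simp: stretch_def intro!: prod_nonneg)

lemma dist_funpow_quad:
  assumes "0 \<le> a"
  shows "\<bar>(quad a ^^ n) x - (quad a ^^ n) y\<bar> = \<bar>x - y\<bar> * stretch a x y n"
proof (induction n)
  case (Suc n)
  show ?case
    using assms by (simp add: quad_diff abs_mult Suc stretch_Suc)
qed simp

lemma stretch_le:
  assumes "0 < a" "a \<le> 2" "x \<in> {-1..1}" "y \<in> {-1..1}"
  shows "stretch a x y n \<le> 4 ^ n"
proof -
  have "a * \<bar>(quad a ^^ i) x + (quad a ^^ i) y\<bar> \<le> 2 * 2" for i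
    using funpow_quad_in_I[OF assms(1,2,3), of i] funpow_quad_in_I[OF assms(1,2,4), of i] assms
    by (intro mult_mono) auto
  then have "stretch a x y n \<le> (\<Prod>i<n. 4)"
    unfolding stretch_def using assms by (intro prod_mono) auto
  then show ?thesis by simp
qed

lemma sum_abs_same_sign:
  fixes x y :: real
  assumes "0 \<le> x * y"
  shows "\<bar>x + y\<bar> = \<bar>x\<bar> + \<bar>y\<bar>"
  using assms by (auto simp: zero_le_mult_iff)

text \<open>For \<open>a > 0\<close> this encodes that the interval between \<open>x\<close> and
  \<open>y\<close> is a homterval: every iterate is monotone on it, and no image has 0 in its
  interior. Endpoints may hit 0.\<close>

definition same_side :: "real \<Rightarrow> real \<Rightarrow> real \<Rightarrow> bool" where
  "same_side a x y \<longleftrightarrow> (\<forall>i. 0 \<le> (quad a ^^ i) x * (quad a ^^ i) y)"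

lemma same_side_funpow: "same_side a x y \<Longrightarrow> same_side a ((quad a ^^ n) x) ((quad a ^^ n) y)"
  by (simp add: same_side_def funpow_add[symmetric, THEN fun_cong, unfolded o_def])

lemma funpow_quad_neq:
  assumes "0 < a" "same_side a x y" "x \<noteq> y"
  shows "(quad a ^^ n) x \<noteq> (quad a ^^ n) y"
proof (induction n)
  case (Suc n)
  let ?u = "(quad a ^^ n) x" and ?v = "(quad a ^^ n) y"
  have "0 \<le> ?u * ?v" using assms(2) by (simp add: same_side_def)
  then have "?u + ?v \<noteq> 0"
    using Suc sum_abs_same_sign[of ?u ?v] by auto
  then show ?case
    using Suc quad_diff[of a ?u ?v] assms(1) by auto
qed (use assms in simp)

text \<open>The weight \<open>sqrt (1 - m\<^sup>2)\<close> is the one for which \<open>f\<^sub>2\<close> expands uniformly by the factor 2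
  (its conjugacy to the tent map). The midpoints of the images of an interval form a pseudo-orbit
  with errors \<open>e\<close> quadratic in the length.\<close>

lemma weighted_expansion_step:
  fixes a \<delta> m e :: real
  assumes d: "0 < \<delta>" "\<delta> \<le> 1/10" and a: "2 - \<delta>\<^sup>2/2 \<le> a" "a \<le> 2"
    and m: "\<delta> \<le> \<bar>m\<bar>" "\<bar>m\<bar> \<le> 1 - \<delta>\<^sup>2" and e: "0 \<le> e" "e \<le> \<delta>^4/8"
  shows "\<bar>1 - a * m\<^sup>2 - e\<bar> \<le> 1 - \<delta>\<^sup>2"
    and "3/2 * sqrt (1 - (1 - a * m\<^sup>2 - e)\<^sup>2) \<le> 2 * a * \<bar>m\<bar> * sqrt (1 - m\<^sup>2)"
proof -
  define s where "s = \<delta>\<^sup>2"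
  define v where "v = m\<^sup>2"
  have s: "0 < s" "s \<le> 1/100" using d power_mono[OF d(2), of 2] by (auto simp: s_def power_divide)
  have d4: "\<delta>^4 = s\<^sup>2" by (simp add: s_def)
  have v1: "s \<le> v" using power_mono[OF m(1), of 2] d by (simp add: s_def v_def)
  have v2: "v \<le> (1 - s)\<^sup>2" using power_mono[OF m(2), of 2] by (simp add: s_def v_def)
  have ss: "s\<^sup>2 \<le> s" using s by (simp add: power2_eq_square mult_left_le_one_le)
  have v3: "v \<le> 1 - s" using v2 ss by (simp add: power2_eq_square algebra_simps)
  have a1: "1 \<le> a" using a(1) s by (simp add: s_def)
  have e2: "e \<le> s/8" using e(2) d4 ss by linarith
  have "1 * s \<le> a * v" using a1 v1 s by (intro mult_mono) auto
  moreover have "a * v \<le> 2 * (1 - 2 * s + s\<^sup>2)"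
    using a v2 v1 s by (intro mult_mono) (auto simp: power2_eq_square algebra_simps)
  moreover have "s\<^sup>2 \<le> s * (1/100)" using s by (simp add: power2_eq_square)
  ultimately show "\<bar>1 - a * m\<^sup>2 - e\<bar> \<le> 1 - \<delta>\<^sup>2"
    using e(1) e2 s unfolding s_def[symmetric] v_def[symmetric] abs_le_iff by argo
  have av: "a * v \<le> 2" using \<open>a * v \<le> 2 * (1 - 2 * s + s\<^sup>2)\<close> ss s by argo
  have "2 - a \<le> s/2" using a(1) by (simp add: s_def)
  \<comment> \<open>After squaring and clearing denominators, the claim for \<open>e = 0\<close> has
    the margin \<open>(a * v) * (16 * a - 18 - 7 * (a * v))\<close>. It is at least
    \<open>s * (6 * s)\<close>, which absorbs the error term \<open>18 * e\<close>.\<close>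
  then have "6 * s \<le> 16 * a - 18 - 7 * (a * v)"
  proof -
    have "7 * (a * v) \<le> 7 * (2 * v)" using a v1 s by (intro mult_left_mono mult_right_mono) auto
    then show ?thesis using \<open>2 - a \<le> s/2\<close> v3 by argo
  qed
  then have "s * (6 * s) \<le> (a * v) * (16 * a - 18 - 7 * (a * v))"
    using \<open>1 * s \<le> a * v\<close> s by (intro mult_mono) auto
  moreover have "18 * e \<le> s * (6 * s)" using e d4 by (simp add: power2_eq_square)
  ultimately have "18 * e \<le> (a * v) * (16 * a - 18 - 7 * (a * v))" by linarith
  moreover have "2 * (1 - a * v) * e - e\<^sup>2 \<le> 2 * e"
  proof -
    have "0 \<le> a * v * e" using e(1) \<open>1 * s \<le> a * v\<close> s by auto
    then show ?thesis using zero_le_power2[of e] by (simp add: algebra_simps) 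
  qed
  moreover have "1 - (1 - a * v - e)\<^sup>2 = a * v * (2 - a * v) + (2 * (1 - a * v) * e - e\<^sup>2)"
    by (simp add: power2_eq_square algebra_simps)
  moreover have "(a * v) * (16 * a - 18 - 7 * (a * v)) = 16 * a\<^sup>2 * v * (1 - v) - 9 * (a * v * (2 - a * v))"
    by (simp add: power2_eq_square algebra_simps)
  ultimately have key: "9 * (1 - (1 - a * v - e)\<^sup>2) \<le> 16 * a\<^sup>2 * v * (1 - v)"
    by argo
  have "3/2 * sqrt (1 - (1 - a * v - e)\<^sup>2) = sqrt ((9/4) * (1 - (1 - a * v - e)\<^sup>2))"
    by (simp only: real_sqrt_mult) (simp add: real_sqrt_divide)
  also have "\<dots> \<le> sqrt (4 * a\<^sup>2 * v * (1 - v))" using key by (intro real_sqrt_le_mono) linarith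
  also have "\<dots> = 2 * a * \<bar>m\<bar> * sqrt (1 - v)"
    using a1 by (simp add: real_sqrt_mult v_def)
  finally show "3/2 * sqrt (1 - (1 - a * m\<^sup>2 - e)\<^sup>2) \<le> 2 * a * \<bar>m\<bar> * sqrt (1 - m\<^sup>2)"
    by (simp add: v_def)
qed

lemma expansion_outside:
  fixes a \<delta> :: real and m e :: "nat \<Rightarrow> real"
  assumes d: "0 < \<delta>" "\<delta> \<le> 1/10" and a: "2 - \<delta>\<^sup>2/2 \<le> a" "a \<le> 2"
    and m: "\<And>i. i < n \<Longrightarrow> \<delta> \<le> \<bar>m i\<bar>" "\<And>i. \<bar>m i\<bar> \<le> 1" and e: "\<And>i. 0 \<le> e i" "\<And>i. e i \<le> \<delta>^4/8"
    and step: "\<And>i. m (Suc i) = 1 - a * (m i)\<^sup>2 - e i"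
  shows "(3/2)^n * sqrt (1 - (m n)\<^sup>2) \<le> (\<Prod>i<n. 2 * a * \<bar>m i\<bar>)"
    and "(3/2)^n * \<delta> \<le> (\<Prod>i<n. 2 * a * \<bar>m i\<bar>)"
proof -
  have s: "0 < \<delta>\<^sup>2" "\<delta>\<^sup>2 \<le> 1/100" using d power_mono[OF d(2), of 2] by (auto simp: power_divide)
  have w1: "sqrt (1 - (m i)\<^sup>2) \<le> 1" for i by simp
  \<comment> \<open>Near the endpoints of \<open>[-1,1]\<close> the weight degenerates, but there
    the factor \<open>2 * a * \<bar>m k\<bar>\<close> alone is at least 3/2. The second alternative
    carries the unweighted bound through such a stay; the first holds after any step that starts
    with \<open>\<bar>m k\<bar> \<le> 1 - \<delta>\<^sup>2\<close>.\<close>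
  have Q: "\<bar>m k\<bar> \<le> 1 - \<delta>\<^sup>2 \<and> (3/2)^k * sqrt (1 - (m k)\<^sup>2) \<le> (\<Prod>i<k. 2 * a * \<bar>m i\<bar>)
      \<or> (3/2)^k \<le> (\<Prod>i<k. 2 * a * \<bar>m i\<bar>)" if "k \<le> n" for k
    using that
  proof (induction k)
    case (Suc k)
    then have mk: "\<delta> \<le> \<bar>m k\<bar>" using m(1) by simp
    show ?case
    proof (cases "\<bar>m k\<bar> \<le> 1 - \<delta>\<^sup>2")
      case True
      have "(3/2)^k * sqrt (1 - (m k)\<^sup>2) \<le> (3/2)^k * 1" by (intro mult_left_mono w1) simp
      then have IH: "(3/2)^k * sqrt (1 - (m k)\<^sup>2) \<le> (\<Prod>i<k. 2 * a * \<bar>m i\<bar>)"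
        using Suc.IH Suc.prems by linarith
      note st = weighted_expansion_step[OF d a mk True e(1)[of k] e(2)[of k], folded step]
      have "(3/2)^Suc k * sqrt (1 - (m (Suc k))\<^sup>2) = (3/2)^k * (3/2 * sqrt (1 - (m (Suc k))\<^sup>2))"
        by simp
      also have "\<dots> \<le> (3/2)^k * (2 * a * \<bar>m k\<bar> * sqrt (1 - (m k)\<^sup>2))"
        by (intro mult_left_mono st) simp
      also have "\<dots> = ((3/2)^k * sqrt (1 - (m k)\<^sup>2)) * (2 * a * \<bar>m k\<bar>)" by simp
      also have "\<dots> \<le> (\<Prod>i<k. 2 * a * \<bar>m i\<bar>) * (2 * a * \<bar>m k\<bar>)"
        using a s by (intro mult_right_mono IH) auto
      finally show ?thesis using st(1) by simp
    next
      case False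
      then have "(3/2)^k \<le> (\<Prod>i<k. 2 * a * \<bar>m i\<bar>)" using Suc by auto
      moreover have "3/2 \<le> 2 * a * \<bar>m k\<bar>"
      proof -
        have "(1::real) * (9/10) \<le> a * \<bar>m k\<bar>" using False a s by (intro mult_mono) auto
        then show ?thesis by simp
      qed
      ultimately have "(3/2)^k * (3/2) \<le> (\<Prod>i<k. 2 * a * \<bar>m i\<bar>) * (2 * a * \<bar>m k\<bar>)"
        using a s by (intro mult_mono prod_nonneg) auto
      then show ?thesis by (simp add: mult.commute)
    qed
  qed simp
  have "(3/2)^n * sqrt (1 - (m n)\<^sup>2) \<le> (3/2)^n * 1" by (intro mult_left_mono w1) simp
  then show "(3/2)^n * sqrt (1 - (m n)\<^sup>2) \<le> (\<Prod>i<n. 2 * a * \<bar>m i\<bar>)"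
    using Q[OF order_refl] by linarith
  \<comment> \<open>Here \<open>1 - (m n)\<^sup>2\<close> is at least
    \<open>1 - \<bar>m n\<bar>\<close>, so the weight costs at most a factor
    \<open>\<delta>\<close>.\<close>
  have "\<delta> \<le> sqrt (1 - (m n)\<^sup>2)" if "\<bar>m n\<bar> \<le> 1 - \<delta>\<^sup>2"
  proof -
    have "(m n)\<^sup>2 \<le> \<bar>m n\<bar> * 1" using m(2)[of n]
      by (metis abs_ge_zero mult_left_mono power2_abs power2_eq_square)
    then have "\<delta>\<^sup>2 \<le> 1 - (m n)\<^sup>2" using that by linarith
    then show ?thesis by (rule real_le_rsqrt)
  qed
  then have "\<bar>m n\<bar> \<le> 1 - \<delta>\<^sup>2 \<Longrightarrow> (3/2)^n * \<delta> \<le> (3/2)^n * sqrt (1 - (m n)\<^sup>2)"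
    by (intro mult_left_mono) auto
  moreover have "(3/2)^n * \<delta> \<le> (3/2)^n * 1" using d by (intro mult_left_mono) auto
  ultimately show "(3/2)^n * \<delta> \<le> (\<Prod>i<n. 2 * a * \<bar>m i\<bar>)"
    using Q[OF order_refl] by linarith
qed

subsection \<open>Binding to the critical orbit\<close>

lemma prod_one_minus_ge:
  fixes u :: "nat \<Rightarrow> real"
  assumes "\<And>i. 0 \<le> u i" "\<And>i. u i \<le> 1"
  shows "1 - (\<Sum>i<n. u i) \<le> (\<Prod>i<n. 1 - u i)"
proof (induction n)
  case (Suc n)
  have "(\<Prod>i<n. 1 - u i) \<le> 1" using assms by (intro prod_le_1) auto
  then have "(\<Prod>i<n. 1 - u i) * u n \<le> 1 * u n" using assms by (intro mult_right_mono) auto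
  then show ?case using Suc by (simp add: algebra_simps)
qed simp

lemma prod_one_plus_le:
  fixes u :: "nat \<Rightarrow> real"
  assumes "\<And>i. 0 \<le> u i"
  shows "(\<Prod>i<n. 1 + u i) \<le> exp (\<Sum>i<n. u i)"
  unfolding exp_sum[OF finite_lessThan] using assms
  by (intro prod_mono) (auto simp: exp_ge_add_one_self add_nonneg_nonneg)

text \<open>\<open>N\<close> is the minimal length of binding: \<open>delta_small\<close> guarantees
  it for points within \<open>2 * \<delta>\<close> of 0, and \<open>N_large\<close> makes binding of
  this length yield expansion by 2. \<open>eps\<close> makes the relative errors during binding sum
  to at most 1/4, and \<open>4 * \<alpha> \<le> \<Lambda>\<close> lets half of the critical growth
  survive.\<close>

locale collet_eckmann =
  fixes a \<Lambda> \<alpha> \<delta> \<epsilon> :: real and N :: nat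
  assumes delta: "0 < \<delta>" "\<delta> \<le> 1/10"
    and a_near_2: "2 - \<delta>\<^sup>2/2 \<le> a" "a \<le> 2"
    and alpha: "0 < \<alpha>" "4 * \<alpha> \<le> \<Lambda>"
    and eps: "0 < \<epsilon>" "\<epsilon> \<le> (1 - exp (- \<alpha>)) / 4"
    and N_large: "32 \<le> \<epsilon> * exp (\<Lambda> * N / 2 - \<Lambda>)"
    and delta_small: "4 ^ N * (4 * \<delta>\<^sup>2) \<le> \<epsilon> * exp (- 2 * \<alpha> * N)"
    and recurrence: "exp (- \<alpha> * Suc j) \<le> \<bar>(quad a ^^ Suc j) 0\<bar>"
    and critical_growth: "exp (\<Lambda> * j) \<le> (\<Prod>i<j. 2 * a * \<bar>(quad a ^^ Suc i) 0\<bar>)"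
begin

lemma a_pos: "0 < a" "1 \<le> a"
proof -
  have "\<delta>\<^sup>2 \<le> 1" using delta by (simp add: abs_square_le_1)
  then show "0 < a" "1 \<le> a" using a_near_2 by simp_all
qed

text \<open>This is the modulus of the derivative of the \<open>n\<close>-th iterate at the critical
  value.\<close>

abbreviation D :: "nat \<Rightarrow> real" where
  "D n \<equiv> \<Prod>i<n. 2 * a * \<bar>(quad a ^^ Suc i) 0\<bar>"

text \<open>The tolerance decays like the square of the recurrence bound
  \<open>exp (- \<alpha> * j)\<close>, so the relative error against the critical orbit is at most
  \<open>\<epsilon> * exp (- \<alpha> * j)\<close>, which is summable.\<close>

definition bound :: "real \<Rightarrow> nat \<Rightarrow> bool" where
  "bound z j \<longleftrightarrow> \<bar>(quad a ^^ j) z - (quad a ^^ j) 0\<bar> \<le> \<epsilon> * exp (- 2 * \<alpha> * j)"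

lemma sum_eps_le: "(\<Sum>i<n. \<epsilon> * exp (- \<alpha> * Suc i)) \<le> 1/4"
proof -
  define q where "q = exp (- \<alpha>)"
  have q: "0 < q" "q < 1" using alpha by (auto simp: q_def)
  have pw: "exp (- \<alpha> * Suc i) = q ^ Suc i" for i
    unfolding q_def exp_of_nat_mult[symmetric] by (simp add: mult.commute)
  have "(1 - q) * (\<Sum>i<n. q ^ Suc i) = q - q ^ Suc n"
    by (induction n) (simp_all add: distrib_left, simp add: algebra_simps)
  moreover have "0 \<le> q ^ Suc n" using q by simp
  ultimately have "(1 - q) * (\<Sum>i<n. q ^ Suc i) \<le> 1" using q by linarith
  moreover have "\<epsilon> * (\<Sum>i<n. q ^ Suc i) \<le> (1 - q) / 4 * (\<Sum>i<n. q ^ Suc i)"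
    using eps q by (intro mult_right_mono sum_nonneg) (auto simp: q_def)
  ultimately show ?thesis unfolding pw sum_distrib_left[symmetric] by simp
qed

lemma eps_le: "\<epsilon> * exp (- \<alpha> * Suc i) \<le> 1"
proof -
  have "\<epsilon> \<le> 1" using eps exp_gt_zero[of "- \<alpha>"] by argo
  moreover have "exp (- \<alpha> * Suc i) \<le> 1" using alpha by simp
  ultimately show ?thesis using eps by (metis exp_ge_zero less_eq_real_def mult_le_one)
qed

text \<open>While both points are bound, each factor of \<open>stretch\<close> differs from that of
  the critical orbit by a relative error of at most \<open>t i\<close>. These errors sum to at most
  1/4, so the quotient of the products lies between 1/2 and 2.\<close>

lemma stretch_bound_period:
  assumes "\<And>j. j < n \<Longrightarrow> bound u (Suc j) \<and> bound v (Suc j)"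
  shows "D n / 2 \<le> stretch a (quad a u) (quad a v) n"
    and "stretch a (quad a u) (quad a v) n \<le> 2 * D n"
proof -
  define t where "t i = \<epsilon> * exp (- \<alpha> * Suc i)" for i
  have t: "0 \<le> t i" "t i \<le> 1" for i using eps_le[of i] eps by (auto simp: t_def)
  have st: "stretch a (quad a u) (quad a v) n = (\<Prod>i<n. a * \<bar>(quad a ^^ Suc i) u + (quad a ^^ Suc i) v\<bar>)"
    by (simp add: stretch_def funpow_swap1)
  have each: "2 * a * \<bar>(quad a ^^ Suc i) 0\<bar> * (1 - t i) \<le> a * \<bar>(quad a ^^ Suc i) u + (quad a ^^ Suc i) v\<bar>"
    "a * \<bar>(quad a ^^ Suc i) u + (quad a ^^ Suc i) v\<bar> \<le> 2 * a * \<bar>(quad a ^^ Suc i) 0\<bar> * (1 + t i)"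
    if "i < n" for i
  proof -
    define c where "c = (quad a ^^ Suc i) 0"
    have "exp (- 2 * \<alpha> * Suc i) = exp (- \<alpha> * Suc i) * exp (- \<alpha> * Suc i)"
      by (simp add: exp_add[symmetric] algebra_simps)
    moreover have "t i * exp (- \<alpha> * Suc i) \<le> t i * \<bar>c\<bar>"
      unfolding c_def by (intro mult_left_mono recurrence t)
    ultimately have "\<epsilon> * exp (- 2 * \<alpha> * Suc i) \<le> \<bar>c\<bar> * t i" by (simp add: t_def mult_ac)
    then have "\<bar>(quad a ^^ Suc i) u - c\<bar> \<le> \<bar>c\<bar> * t i" "\<bar>(quad a ^^ Suc i) v - c\<bar> \<le> \<bar>c\<bar> * t i"
      using assms[OF that] unfolding bound_def c_def by linarith+
    then have "2 * \<bar>c\<bar> * (1 - t i) \<le> \<bar>(quad a ^^ Suc i) u + (quad a ^^ Suc i) v\<bar>"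
      "\<bar>(quad a ^^ Suc i) u + (quad a ^^ Suc i) v\<bar> \<le> 2 * \<bar>c\<bar> * (1 + t i)"
      unfolding right_diff_distrib distrib_left by linarith+
    then have "a * (2 * \<bar>c\<bar> * (1 - t i)) \<le> a * \<bar>(quad a ^^ Suc i) u + (quad a ^^ Suc i) v\<bar>"
      "a * \<bar>(quad a ^^ Suc i) u + (quad a ^^ Suc i) v\<bar> \<le> a * (2 * \<bar>c\<bar> * (1 + t i))"
      using a_pos by (simp_all only: mult_le_cancel_left_pos)
    then show "2 * a * \<bar>(quad a ^^ Suc i) 0\<bar> * (1 - t i) \<le> a * \<bar>(quad a ^^ Suc i) u + (quad a ^^ Suc i) v\<bar>"
      "a * \<bar>(quad a ^^ Suc i) u + (quad a ^^ Suc i) v\<bar> \<le> 2 * a * \<bar>(quad a ^^ Suc i) 0\<bar> * (1 + t i)"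
      by (simp_all add: c_def mult_ac)
  qed
  have D0: "0 \<le> D n" using a_pos by (intro prod_nonneg) auto
  have sum_t: "(\<Sum>i<n. t i) \<le> 1/4" using sum_eps_le by (simp add: t_def)
  have "1/2 \<le> (\<Prod>i<n. 1 - t i)" using prod_one_minus_ge[of t n, OF t] sum_t by linarith
  then have "D n * (1/2) \<le> D n * (\<Prod>i<n. 1 - t i)" by (intro mult_left_mono D0)
  also have "\<dots> = (\<Prod>i<n. 2 * a * \<bar>(quad a ^^ Suc i) 0\<bar> * (1 - t i))" by (simp only: prod.distrib)
  also have "\<dots> \<le> stretch a (quad a u) (quad a v) n"
    unfolding st using each(1) t a_pos by (intro prod_mono conjI) (auto simp del: funpow.simps)
  finally show "D n / 2 \<le> stretch a (quad a u) (quad a v) n" by simp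
  have "(\<Prod>i<n. 1 + t i) \<le> exp (1/4)"
    using prod_one_plus_le[of t n, OF t(1)] sum_t by (meson exp_le_cancel_iff order_trans)
  also have "exp (1/4) \<le> (2::real)"
    using exp_bound[of "1/4"] by (simp add: power2_eq_square)
  finally have le2: "(\<Prod>i<n. 1 + t i) \<le> 2" .
  have "stretch a (quad a u) (quad a v) n \<le> (\<Prod>i<n. 2 * a * \<bar>(quad a ^^ Suc i) 0\<bar> * (1 + t i))"
    unfolding st using each(2) a_pos by (intro prod_mono conjI) (auto simp del: funpow.simps)
  also have "\<dots> = D n * (\<Prod>i<n. 1 + t i)" by (simp only: prod.distrib)
  also have "\<dots> \<le> D n * 2" by (intro mult_left_mono D0 le2)
  finally show "stretch a (quad a u) (quad a v) n \<le> 2 * D n" by simp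
qed

lemma bound_0: "bound 0 j"
  using eps by (simp add: bound_def)

lemma dist_to_critical:
  "\<bar>(quad a ^^ Suc n) z - (quad a ^^ Suc n) 0\<bar> = a * z\<^sup>2 * stretch a (quad a z) (quad a 0) n"
proof -
  have "(quad a ^^ Suc n) w = (quad a ^^ n) (quad a w)" for w by (simp add: funpow_swap1)
  moreover have "\<bar>quad a z - quad a 0\<bar> = a * z\<^sup>2" using a_pos by (simp add: quad_def)
  ultimately show ?thesis using dist_funpow_quad[of a n "quad a z" "quad a 0"] a_pos by simp
qed

text \<open>Endless binding would let the initial gap \<open>a * z\<^sup>2\<close> grow like the
  critical derivative, against the bounded tolerance.\<close>

lemma bound_period_ends:
  assumes "z \<noteq> 0"
  shows "\<exists>j. \<not> bound z (Suc j)"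
proof (rule ccontr)
  assume "\<not> ?thesis"
  then have b: "bound z (Suc j)" for j by auto
  have "0 < \<Lambda>" using alpha by linarith
  then obtain n :: nat where n: "2 / z\<^sup>2 < n * \<Lambda>" by (metis reals_Archimedean3)
  have "\<epsilon> * exp (- 2 * \<alpha> * Suc n) \<le> 1 * 1"
    using eps alpha exp_gt_zero[of "- \<alpha>"] by (intro mult_mono) (argo, auto)
  then have "a * z\<^sup>2 * stretch a (quad a z) (quad a 0) n \<le> 1"
    using b[of n] unfolding bound_def dist_to_critical by linarith
  moreover have "1 * z\<^sup>2 * (exp (\<Lambda> * n) / 2) \<le> a * z\<^sup>2 * stretch a (quad a z) (quad a 0) n"
  proof (intro mult_mono)
    show "exp (\<Lambda> * n) / 2 \<le> stretch a (quad a z) (quad a 0) n"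
      using stretch_bound_period(1)[of n z 0, OF conjI[OF b bound_0]] critical_growth[of n] by linarith
  qed (use a_pos in auto)
  moreover have "2 / z\<^sup>2 < exp (\<Lambda> * n)"
    using n exp_ge_add_one_self[of "\<Lambda> * n"] by argo
  then have "2 < exp (\<Lambda> * n) * z\<^sup>2" using assms by (simp add: divide_less_eq)
  ultimately show False by (simp add: mult.commute)
qed

text \<open>The fold at 0 costs a factor \<open>\<bar>z\<bar>\<close>, but binding lasts until
  \<open>z\<^sup>2 * D n\<close> has reached the tolerance. Hence, up to constants,
  \<open>(\<bar>z\<bar> * D n)\<^sup>2\<close> is at least
  \<open>D n * exp (- 2 * \<alpha> * n)\<close>, and \<open>4 * \<alpha> \<le> \<Lambda>\<close>
  makes this large when binding is long.\<close>

lemma expansion_inside: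
  assumes I: "x \<in> {-1..1}" "y \<in> {-1..1}" and ne: "x \<noteq> y" and ss: "same_side a x y"
    and small: "\<bar>x + y\<bar> < 2 * \<delta>"
  shows "\<exists>p. 2 \<le> stretch a x y p"
proof -
  define B where "B j \<longleftrightarrow> bound x (Suc j) \<and> bound y (Suc j)" for j
  have "\<exists>j. \<not> B j" using bound_period_ends[of x] bound_period_ends[of y] ne
    unfolding B_def by metis
  define n where "n = (LEAST j. \<not> B j)"
  have nB: "\<not> B n" using \<open>\<exists>j. \<not> B j\<close> unfolding n_def by (rule LeastI_ex)
  have Bj: "B j" if "j < n" for j using not_less_Least that unfolding n_def by blast
  obtain z where z: "z \<in> {x, y}" "\<not> bound z (Suc n)" using nB unfolding B_def by auto
  have "0 \<le> x * y" using ss[unfolded same_side_def, rule_format, of 0] by simp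
  then have zle: "\<bar>z\<bar> \<le> \<bar>x + y\<bar>" using z(1) by (auto simp: sum_abs_same_sign)
  have Bz: "bound z (Suc j) \<and> bound 0 (Suc j)" if "j < n" for j
    using Bj[OF that] z(1) bound_0 unfolding B_def by auto
  have zI: "z \<in> {-1..1}" using z(1) I by auto
  have far: "\<epsilon> * exp (- 2 * \<alpha> * Suc n) < a * z\<^sup>2 * stretch a (quad a z) (quad a 0) n"
    using z(2) unfolding bound_def dist_to_critical by simp
  \<comment> \<open>The crude expansion bound 4 per iteration keeps a point with
    \<open>\<bar>z\<bar> < 2 * \<delta>\<close> bound until time \<open>N\<close>.\<close>
  have "N \<le> Suc n"
  proof (rule ccontr)
    assume "\<not> N \<le> Suc n"
    have z4: "z\<^sup>2 \<le> 4 * \<delta>\<^sup>2"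
      using power_mono[of "\<bar>z\<bar>" "2 * \<delta>" 2] zle small by (simp add: power_mult_distrib)
    have "a * z\<^sup>2 * stretch a (quad a z) (quad a 0) n \<le> 2 * (4 * \<delta>\<^sup>2) * 4 ^ n"
      using a_pos a_near_2 z4 zI
      by (intro mult_mono stretch_le quad_in_I stretch_nonneg) auto
    also have "\<dots> \<le> 4 ^ Suc n * (4 * \<delta>\<^sup>2)" by simp
    also have "\<dots> \<le> 4 ^ N * (4 * \<delta>\<^sup>2)"
      using \<open>\<not> N \<le> Suc n\<close> by (intro mult_right_mono power_increasing) auto
    also have "\<dots> \<le> \<epsilon> * exp (- 2 * \<alpha> * N)" by (rule delta_small)
    also have "\<dots> \<le> \<epsilon> * exp (- 2 * \<alpha> * Suc n)"
      using eps alpha \<open>\<not> N \<le> Suc n\<close> by (auto simp del: of_nat_Suc)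
    finally show False using far by simp
  qed
  have D0: "0 \<le> D n" using a_pos by (intro prod_nonneg) auto
  define G where "G = stretch a x y (Suc n)"
  have G: "G = a * \<bar>x + y\<bar> * stretch a (quad a x) (quad a y) n"
    using stretch_add[of a x y 1 n] by (simp add: G_def stretch_Suc[of _ _ _ 0, simplified])
  have "a * \<bar>z\<bar> * (D n / 2) \<le> G"
    unfolding G using a_pos zle D0 stretch_bound_period(1)[of n x y] Bj
    by (intro mult_mono) (auto simp: B_def)
  then have "(a * \<bar>z\<bar> * (D n / 2))\<^sup>2 \<le> G\<^sup>2" using a_pos D0 by (intro power_mono) auto
  \<comment> \<open>The square is split so that one factor carries the derivative growth and the
    other bounds the gap to the critical orbit at the end of binding.\<close>
  then have G2: "(a * D n / 8) * (a * z\<^sup>2 * (2 * D n)) \<le> G\<^sup>2"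
    by (simp add: power2_eq_square algebra_simps)
  have "a * z\<^sup>2 * stretch a (quad a z) (quad a 0) n \<le> a * z\<^sup>2 * (2 * D n)"
    using a_pos stretch_bound_period(2)[of n z 0] Bz by (intro mult_left_mono) auto
  then have far': "\<epsilon> * exp (- 2 * \<alpha> * Suc n) \<le> a * z\<^sup>2 * (2 * D n)" using far by linarith
  have "1 * exp (\<Lambda> * n) / 8 \<le> a * D n / 8"
    using a_pos critical_growth[of n] by (intro divide_right_mono mult_mono) auto
  then have "1 * exp (\<Lambda> * n) / 8 * (\<epsilon> * exp (- 2 * \<alpha> * Suc n)) \<le> (a * D n / 8) * (a * z\<^sup>2 * (2 * D n))"
    using eps a_pos D0 by (intro mult_mono far') auto
  also note G2
  finally have "\<epsilon> * (exp (\<Lambda> * n) * exp (- 2 * \<alpha> * Suc n)) \<le> 8 * G\<^sup>2" by (simp add: mult_ac)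
  moreover have "\<epsilon> * exp (\<Lambda> * N / 2 - \<Lambda>) \<le> \<epsilon> * (exp (\<Lambda> * n) * exp (- 2 * \<alpha> * Suc n))"
  proof -
    have "\<Lambda> * N \<le> \<Lambda> * Suc n" using \<open>N \<le> Suc n\<close> alpha by (intro mult_left_mono) auto
    moreover have "4 * \<alpha> * Suc n \<le> \<Lambda> * Suc n" using alpha by (intro mult_right_mono) auto
    ultimately have "\<Lambda> * N / 2 - \<Lambda> \<le> \<Lambda> * n + - 2 * \<alpha> * Suc n" by (simp add: algebra_simps)
    then show ?thesis using eps unfolding exp_add[symmetric] by simp
  qed
  ultimately have "2\<^sup>2 \<le> G\<^sup>2" using N_large by simp
  moreover have "0 \<le> G" using a_pos by (simp add: G_def stretch_nonneg)
  ultimately have "2 \<le> G" using power2_le_imp_le by blast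
  then show ?thesis unfolding G_def by blast
qed

text \<open>The midpoints satisfy the recursion of \<open>expansion_outside\<close> with error
  \<open>a * d\<^sup>2 / 4\<close>, where \<open>d\<close> is the distance of the two images. The
  threshold \<open>\<delta>\<^sup>2 / 2\<close> keeps this error at most
  \<open>\<delta>^4 / 8\<close>.\<close>

lemma expansion_to_return:
  assumes I: "x \<in> {-1..1}" "y \<in> {-1..1}"
    and short: "\<And>n. \<bar>(quad a ^^ n) x - (quad a ^^ n) y\<bar> < \<delta>\<^sup>2 / 2"
    and out: "\<And>i. i < n \<Longrightarrow> 2 * \<delta> \<le> \<bar>(quad a ^^ i) x + (quad a ^^ i) y\<bar>"
  shows "(3/2)^n * sqrt (1 - (((quad a ^^ n) x + (quad a ^^ n) y) / 2)\<^sup>2) \<le> stretch a x y n"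
    and "(3/2)^n * \<delta> \<le> stretch a x y n"
proof -
  define m where "m i = ((quad a ^^ i) x + (quad a ^^ i) y) / 2" for i
  define e where "e i = a * ((quad a ^^ i) x - (quad a ^^ i) y)\<^sup>2 / 4" for i
  have st: "stretch a x y n = (\<Prod>i<n. 2 * a * \<bar>m i\<bar>)"
    unfolding stretch_def m_def by (intro prod.cong) auto
  have 1: "\<delta> \<le> \<bar>m i\<bar>" if "i < n" for i using out[OF that] by (simp add: m_def)
  have 2: "\<bar>m i\<bar> \<le> 1" for i
    using funpow_quad_in_I[OF a_pos(1) a_near_2(2) I(1), of i] funpow_quad_in_I[OF a_pos(1) a_near_2(2) I(2), of i]
    by (auto simp: m_def abs_le_iff)
  have 3: "0 \<le> e i" for i using a_pos by (simp add: e_def)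
  have 4: "e i \<le> \<delta>^4/8" for i
  proof -
    have "((quad a ^^ i) x - (quad a ^^ i) y)\<^sup>2 \<le> (\<delta>\<^sup>2/2)\<^sup>2"
      using short[of i] power_mono[of "\<bar>(quad a ^^ i) x - (quad a ^^ i) y\<bar>" "\<delta>\<^sup>2/2" 2] by simp
    then have "a * ((quad a ^^ i) x - (quad a ^^ i) y)\<^sup>2 \<le> 2 * (\<delta>\<^sup>2/2)\<^sup>2"
      using a_pos a_near_2 by (intro mult_mono) auto
    then show ?thesis by (simp add: e_def power2_eq_square power4_eq_xxxx)
  qed
  have 5: "m (Suc i) = 1 - a * (m i)\<^sup>2 - e i" for i
    by (simp add: m_def e_def quad_def power2_eq_square field_simps)
  note * = expansion_outside[where n = n and m = m and e = e, OF delta a_near_2 1 2 3 4 5]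
  show "(3/2)^n * sqrt (1 - (((quad a ^^ n) x + (quad a ^^ n) y) / 2)\<^sup>2) \<le> stretch a x y n"
    using * unfolding st by (simp add: m_def)
  show "(3/2)^n * \<delta> \<le> stretch a x y n"
    using * unfolding st by simp
qed

text \<open>Each round consists of the free time up to the first midpoint closer than
  \<open>\<delta>\<close> to 0, which loses nothing, and the binding after it, which gains a factor
  2. If no midpoint comes that close, \<open>expansion_to_return\<close> alone gives unbounded
  growth.\<close>

lemma stretch_unbounded:
  assumes "x \<in> {-1..1}" "y \<in> {-1..1}" "x \<noteq> y" "same_side a x y"
    and "\<And>n. \<bar>(quad a ^^ n) x - (quad a ^^ n) y\<bar> < \<delta>\<^sup>2 / 2"
  shows "\<exists>n. 2 ^ k \<le> stretch a x y n"
  using assms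
proof (induction k arbitrary: x y)
  case 0
  have "2 ^ 0 \<le> stretch a x y 0" by simp
  then show ?case by blast
next
  case (Suc k)
  show ?case
  proof (cases "\<forall>i. 2 * \<delta> \<le> \<bar>(quad a ^^ i) x + (quad a ^^ i) y\<bar>")
    case True
    obtain n where "2 ^ Suc k / \<delta> < (3/2 :: real) ^ n"
      using real_arch_pow[of "3/2"] by auto
    then have "2 ^ Suc k \<le> (3/2)^n * \<delta>" using delta by (simp add: divide_less_eq)
    also have "\<dots> \<le> stretch a x y n" using expansion_to_return(2) Suc.prems True by blast
    finally show ?thesis by blast
  next
    case False
    define n where "n = (LEAST i. \<bar>(quad a ^^ i) x + (quad a ^^ i) y\<bar> < 2 * \<delta>)"
    have n: "\<bar>(quad a ^^ n) x + (quad a ^^ n) y\<bar> < 2 * \<delta>"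
      unfolding n_def by (rule LeastI_ex) (use False in \<open>simp add: not_le\<close>)
    have out: "2 * \<delta> \<le> \<bar>(quad a ^^ i) x + (quad a ^^ i) y\<bar>" if "i < n" for i
      using not_less_Least[of i "\<lambda>i. \<bar>(quad a ^^ i) x + (quad a ^^ i) y\<bar> < 2 * \<delta>"] that
      unfolding n_def by (simp add: not_less)
    have n1: "1 \<le> stretch a x y n"
    proof (cases "n = 0")
      case False
      let ?m = "((quad a ^^ n) x + (quad a ^^ n) y) / 2"
      have "\<bar>?m\<bar> = \<bar>(quad a ^^ n) x + (quad a ^^ n) y\<bar> / 2" by simp
      then have "\<bar>?m\<bar> \<le> 1/10" using n delta by argo
      from power_mono[OF this, of 2] have "?m\<^sup>2 \<le> 1/100" by (simp add: power_divide)
      \<comment> \<open>At a return the weight is at least 9/10, so a single free step already gives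
        \<open>3/2 * 9/10 > 1\<close>.\<close>
      then have "9/10 \<le> sqrt (1 - ?m\<^sup>2)" by (intro real_le_rsqrt) (simp add: power_divide)
      moreover have "(3/2::real)^1 \<le> (3/2)^n" using False by (intro power_increasing) auto
      ultimately have "(3/2) * (9/10) \<le> (3/2)^n * sqrt (1 - ?m\<^sup>2)" by (intro mult_mono) auto
      also have "\<dots> \<le> stretch a x y n" using expansion_to_return(1) Suc.prems out by blast
      finally show ?thesis by simp
    qed simp
    let ?x = "(quad a ^^ n) x" and ?y = "(quad a ^^ n) y"
    have prems1: "?x \<in> {-1..1}" "?y \<in> {-1..1}" "?x \<noteq> ?y" "same_side a ?x ?y"
      using Suc.prems funpow_quad_in_I funpow_quad_neq same_side_funpow a_pos a_near_2 by blast+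
    obtain p where p: "2 \<le> stretch a ?x ?y p"
      using expansion_inside[OF prems1 n] by blast
    let ?q = "n + p"
    have 2: "1 * 2 \<le> stretch a x y ?q"
      unfolding stretch_add using n1 p by (intro mult_mono) auto
    let ?x = "(quad a ^^ ?q) x" and ?y = "(quad a ^^ ?q) y"
    have "?x \<in> {-1..1}" "?y \<in> {-1..1}" "?x \<noteq> ?y" "same_side a ?x ?y"
      using Suc.prems funpow_quad_in_I funpow_quad_neq same_side_funpow a_pos a_near_2 by blast+
    moreover have "\<bar>(quad a ^^ i) ?x - (quad a ^^ i) ?y\<bar> < \<delta>\<^sup>2 / 2" for i
      using Suc.prems(5)[of "i + ?q"] by (simp only: funpow_add o_apply)
    ultimately obtain r where r: "2 ^ k \<le> stretch a ?x ?y r" using Suc.IH by blast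
    have "2 * 2 ^ k \<le> stretch a x y (?q + r)"
      unfolding stretch_add[of a x y ?q r] using 2 r by (intro mult_mono) auto
    then show ?thesis by auto
  qed
qed

text \<open>Unbounded \<open>stretch\<close> is incompatible with images inside an interval of
  length 2, so the images cannot all stay short.\<close>

lemma homterval_becomes_long:
  assumes "x \<in> {-1..1}" "y \<in> {-1..1}" "x \<noteq> y" "same_side a x y"
  shows "\<exists>n. \<delta>\<^sup>2 / 2 \<le> \<bar>(quad a ^^ n) x - (quad a ^^ n) y\<bar>"
proof (rule ccontr)
  assume "\<not> ?thesis"
  then have short: "\<bar>(quad a ^^ n) x - (quad a ^^ n) y\<bar> < \<delta>\<^sup>2 / 2" for n
    by (auto simp: not_le)
  obtain k where k: "2 / \<bar>x - y\<bar> < (2::real) ^ k" using real_arch_pow[of 2] by auto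
  obtain n where n: "2 ^ k \<le> stretch a x y n" using stretch_unbounded[OF assms short] by blast
  have "2 < \<bar>x - y\<bar> * 2 ^ k" using k assms(3) by (simp add: divide_less_eq mult.commute)
  also have "\<dots> \<le> \<bar>x - y\<bar> * stretch a x y n" by (intro mult_left_mono n) auto
  also have "\<dots> = \<bar>(quad a ^^ n) x - (quad a ^^ n) y\<bar>" using a_pos by (simp add: dist_funpow_quad)
  also have "\<dots> \<le> 2"
    using funpow_quad_in_I[OF a_pos(1) a_near_2(2) assms(1), of n] funpow_quad_in_I[OF a_pos(1) a_near_2(2) assms(2), of n]
    by auto
  finally show False by simp
qed

end

subsection \<open>Absence of homtervals\<close>

text \<open>Strictness makes the relation transitive; with \<open>same_side\<close> an orbit hitting
  0 could mediate between points on opposite sides.\<close>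

definition strict_side :: "real \<Rightarrow> real \<Rightarrow> real \<Rightarrow> bool" where
  "strict_side a x y \<longleftrightarrow> (\<forall>i. 0 < (quad a ^^ i) x * (quad a ^^ i) y)"

lemma strict_side_sym: "strict_side a x y \<Longrightarrow> strict_side a y x"
  by (simp add: strict_side_def mult.commute)

lemma strict_side_trans: "strict_side a x y \<Longrightarrow> strict_side a y z \<Longrightarrow> strict_side a x z"
  unfolding strict_side_def by (metis zero_less_mult_iff less_asym)

lemma strict_side_same_side: "strict_side a x y \<Longrightarrow> same_side a x y"
  by (simp add: strict_side_def same_side_def less_imp_le)

lemma strict_side_funpow: "strict_side a x y \<Longrightarrow> strict_side a ((quad a ^^ n) x) ((quad a ^^ n) y)"
  by (simp add: strict_side_def funpow_add[symmetric, THEN fun_cong, unfolded o_def])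

definition strictly_between :: "real \<Rightarrow> real \<Rightarrow> real \<Rightarrow> bool" where
  "strictly_between x y u \<longleftrightarrow> min x y < u \<and> u < max x y"

lemma strictly_between_quad:
  assumes "0 < a" "0 \<le> x * y" "strictly_between x y u"
  shows "strictly_between (quad a x) (quad a y) (quad a u)"
proof -
  have *: "strictly_between (quad a x) (quad a y) (quad a u)"
    if "0 \<le> x * y" "x < u" "u < y" for x y
  proof -
    have "0 \<le> x \<or> y \<le> 0" using that by (auto simp: zero_le_mult_iff)
    then have "x\<^sup>2 < u\<^sup>2 \<and> u\<^sup>2 < y\<^sup>2 \<or> y\<^sup>2 < u\<^sup>2 \<and> u\<^sup>2 < x\<^sup>2"
    proof
      assume "0 \<le> x"
      then show ?thesis using that power_strict_mono[of x u 2] power_strict_mono[of u y 2] by simp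
    next
      assume "y \<le> 0"
      then show ?thesis using that power_strict_mono[of "-y" "-u" 2] power_strict_mono[of "-u" "-x" 2] by simp
    qed
    then show ?thesis using assms(1) by (auto simp: strictly_between_def quad_def min_def max_def)
  qed
  show ?thesis
  proof (cases "x < y")
    case True
    then show ?thesis using *[of x y] assms by (simp add: strictly_between_def)
  next
    case False
    then show ?thesis using *[of y x] assms
      by (simp add: strictly_between_def mult.commute min.commute max.commute)
  qed
qed

lemma strictly_between_funpow:
  assumes "0 < a" "same_side a x y" "strictly_between x y u"
  shows "strictly_between ((quad a ^^ i) x) ((quad a ^^ i) y) ((quad a ^^ i) u)"
proof (induction i)
  case (Suc i)
  have "0 \<le> (quad a ^^ i) x * (quad a ^^ i) y" using assms(2) by (simp add: same_side_def)
  then show ?case using strictly_between_quad[OF assms(1) _ Suc] by simp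
qed (use assms in simp)

text \<open>Iterates are monotone on a homterval, so interior points stay strictly inside its images
  and never reach 0.\<close>

lemma strict_side_interior:
  assumes "0 < a" "same_side a x y" "strictly_between x y u" "strictly_between x y v"
  shows "strict_side a u v"
  unfolding strict_side_def
proof
  fix i
  have "0 \<le> (quad a ^^ i) x * (quad a ^^ i) y" using assms(2) by (simp add: same_side_def)
  moreover note strictly_between_funpow[OF assms(1,2,3), of i] strictly_between_funpow[OF assms(1,2,4), of i]
  ultimately show "0 < (quad a ^^ i) u * (quad a ^^ i) v"
    by (auto simp: strictly_between_def zero_le_mult_iff zero_less_mult_iff min_def max_def split: if_splits)
qed

definition signed_stretch :: "real \<Rightarrow> real \<Rightarrow> real \<Rightarrow> nat \<Rightarrow> real" where
  "signed_stretch a x y n = (\<Prod>i<n. - (a * ((quad a ^^ i) x + (quad a ^^ i) y)))"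

lemma funpow_quad_diff:
  "(quad a ^^ n) x - (quad a ^^ n) y = (x - y) * signed_stretch a x y n"
  by (induction n) (simp_all add: signed_stretch_def quad_diff)

text \<open>Each factor has the sign opposite to that of the image of \<open>g\<close>, so the
  orientation of an iterate depends only on the itinerary.\<close>

lemma signed_stretch_same_sign:
  assumes "0 < a" "strict_side a u g" "strict_side a v g"
  shows "0 < signed_stretch a u v n * signed_stretch a g g n"
  unfolding signed_stretch_def prod.distrib[symmetric]
proof (rule prod_pos)
  fix i
  let ?u = "(quad a ^^ i) u" and ?v = "(quad a ^^ i) v" and ?g = "(quad a ^^ i) g"
  have "0 < ?u * ?g" "0 < ?v * ?g" using assms by (auto simp: strict_side_def)
  then have "0 < 2 * (a * a) * (?u * ?g + ?v * ?g)" using assms(1) by simp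
  then show "0 < - (a * (?u + ?v)) * - (a * (?g + ?g))" by (simp add: algebra_simps)
qed

lemma continuous_on_funpow_quad [continuous_intros]:
  assumes "continuous_on A f" "continuous_on A g"
  shows "continuous_on A (\<lambda>z. (quad (f z) ^^ n) (g z))"
proof (induction n)
  case (Suc n)
  then show ?case unfolding funpow_quad_Suc unfolding quad_def by (intro continuous_intros assms)
qed (use assms in simp)

lemma IVT_strictly_between:
  fixes f :: "real \<Rightarrow> real"
  assumes "continuous_on UNIV f" "strictly_between (f x) (f y) g"
  shows "\<exists>u. strictly_between x y u \<and> f u = g"
proof -
  have "connected (f ` closed_segment x y)"
    using assms(1) by (intro connected_continuous_image) (auto intro: continuous_on_subset)
  then have "is_interval (f ` closed_segment x y)" by (simp add: is_interval_connected_1)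
  moreover have "f x \<in> f ` closed_segment x y" "f y \<in> f ` closed_segment x y" by auto
  ultimately have "g \<in> f ` closed_segment x y"
    using assms(2) unfolding is_interval_1 strictly_between_def
    by (smt (verit) min_def max_def)
  then obtain u where u: "u \<in> closed_segment x y" "f u = g" by auto
  then have "u \<noteq> x" "u \<noteq> y" using assms(2) by (auto simp: strictly_between_def)
  then show ?thesis
    using u unfolding strictly_between_def closed_segment_eq_real_ivl
    by (intro exI[of _ u]) (auto simp: min_def max_def split: if_splits)
qed

text \<open>A grid of mesh \<open>c/2\<close> has a point strictly inside every interval of length
  at least \<open>c\<close>, namely the first one to the right of its left end. Only finitely many
  grid points are available, so one lies in infinitely many of the long intervals.\<close>

lemma overlapping_iterates:
  fixes X Y :: "nat \<Rightarrow> real"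
  assumes "0 < c" "\<And>n. X n \<in> {-1..1}" "\<And>n. Y n \<in> {-1..1}" "\<And>n. \<exists>m\<ge>n. c \<le> \<bar>X m - Y m\<bar>"
  shows "\<exists>g n m. n < m \<and> strictly_between (X n) (Y n) g \<and> strictly_between (X m) (Y m) g"
proof -
  define A where "A = {n. c \<le> \<bar>X n - Y n\<bar>}"
  define k where "k n = \<lfloor>min (X n) (Y n) / (c/2)\<rfloor>" for n
  have "infinite A"
    unfolding A_def infinite_nat_iff_unbounded_le using assms(4) by auto
  moreover have "k n \<in> {\<lfloor>- 1 / (c/2)\<rfloor>..\<lfloor>1 / (c/2)\<rfloor>}" for n
    using assms(1) assms(2)[of n] assms(3)[of n] unfolding k_def atLeastAtMost_iff
    by (intro conjI floor_mono divide_right_mono) auto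
  then have "finite (k ` A)" by (meson finite_atLeastAtMost_int finite_subset image_subsetI)
  ultimately obtain n0 where n0: "infinite {n \<in> A. k n = k n0}"
    using pigeonhole_infinite[of A k] by auto
  define g where "g = (of_int (k n0) + 1) * (c/2)"
  have g: "strictly_between (X n) (Y n) g" if "n \<in> A" "k n = k n0" for n
  proof -
    define lo where "lo = min (X n) (Y n)"
    have "of_int (k n) \<le> lo / (c/2)" "lo / (c/2) < of_int (k n) + 1"
      unfolding k_def lo_def by linarith+
    then have "of_int (k n) * (c/2) \<le> lo" "lo < g"
      using assms(1) that(2) by (simp_all add: field_simps g_def)
    moreover have "max (X n) (Y n) = lo + \<bar>X n - Y n\<bar>" by (auto simp: lo_def)
    moreover have "g = of_int (k n) * (c/2) + c/2" by (simp add: g_def that(2) algebra_simps)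
    ultimately show ?thesis
      using that(1) assms(1) 
      unfolding strictly_between_def A_def lo_def[symmetric] by auto
  qed
  obtain n where n: "n \<in> A" "k n = k n0" using n0 not_finite_existsD by auto
  obtain m where "n < m" "m \<in> A" "k m = k n0" using n0 unfolding infinite_nat_iff_unbounded by auto
  then show ?thesis using g n by blast
qed

text \<open>The returning interval generates the class \<open>K\<close> of all points with the itinerary of \<open>g\<close>.
  On \<open>K\<close> the map \<open>f\<^sup>2\<^sup>q\<close> is increasing, so its orbits converge and produce a homterval whose
  images all stay short.\<close>

lemma no_homterval:
  assumes a: "0 < a" "a \<le> 2" and c: "0 < c"
    and long: "\<And>x y. x \<in> {-1..1} \<Longrightarrow> y \<in> {-1..1} \<Longrightarrow> x \<noteq> y \<Longrightarrow> same_side a x y \<Longrightarrow>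
      \<exists>n. c \<le> \<bar>(quad a ^^ n) x - (quad a ^^ n) y\<bar>"
    and xy: "x \<in> {-1..1}" "y \<in> {-1..1}" "same_side a x y"
  shows "x = y"
proof (rule ccontr)
  assume ne: "x \<noteq> y"
  define f where "f n = quad a ^^ n" for n
  have fadd: "f (n + m) z = f n (f m z)" for n m z by (simp add: f_def funpow_add)
  have fI: "f n z \<in> {-1..1}" if "z \<in> {-1..1}" for n z
    unfolding f_def using funpow_quad_in_I a that by blast
  have "\<exists>m\<ge>n. c \<le> \<bar>f m x - f m y\<bar>" for n
  proof -
    have "f n x \<noteq> f n y" "same_side a (f n x) (f n y)"
      unfolding f_def using xy ne a funpow_quad_neq same_side_funpow by blast+
    then obtain m where "c \<le> \<bar>f m (f n x) - f m (f n y)\<bar>"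
      using long fI xy unfolding f_def by blast
    then show ?thesis by (intro exI[of _ "m + n"]) (simp add: fadd)
  qed
  then obtain g n m where nm: "n < m" and gn: "strictly_between (f n x) (f n y) g"
    and gm: "strictly_between (f m x) (f m y) g"
    using overlapping_iterates[of c "\<lambda>n. f n x" "\<lambda>n. f n y"] c fI xy by blast
  define q where "q = m - n"
  have "m = q + n" using nm by (simp add: q_def)
  then have gm': "strictly_between (f q (f n x)) (f q (f n y)) g" using gm by (simp add: fadd)
  have "continuous_on UNIV (f q)" unfolding f_def by (intro continuous_intros)
  \<comment> \<open>\<open>g\<close> lies in two images of the homterval, \<open>q\<close> steps
    apart; pulling it back by \<open>f q\<close> gives \<open>g1\<close> in the earlier one. As
    \<open>g1\<close> has the itinerary of \<open>g\<close>, the map \<open>f q\<close> sends the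
    class of \<open>g\<close> into itself.\<close>
  then obtain g1 where g1: "strictly_between (f n x) (f n y) g1" "f q g1 = g"
    using IVT_strictly_between gm' by blast
  have ssn: "same_side a (f n x) (f n y)" unfolding f_def using xy same_side_funpow by blast
  have gg1: "strict_side a g g1" by (rule strict_side_interior[OF a(1) ssn gn g1(1)])
  define K where "K = {z \<in> {-1..1}. strict_side a z g}"
  have Kq: "f q z \<in> K" if "z \<in> K" for z
    using that strict_side_trans[OF _ gg1] g1(2) strict_side_funpow[of a z g1 q] fI
    unfolding K_def f_def by auto
  \<comment> \<open>The iterate is doubled because \<open>f q\<close> may reverse orientation on
    \<open>K\<close>, whereas its square is increasing.\<close>
  define h where "h = f (2 * q)"
  have hq: "h z = f q (f q z)" for z unfolding h_def by (simp add: mult_2 fadd)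
  have hK: "h z \<in> K" if "z \<in> K" for z unfolding hq using that Kq by blast
  have h_mono: "h u < h v" if "u \<in> K" "v \<in> K" "u < v" for u v
  proof -
    have "0 < signed_stretch a u v q * signed_stretch a g g q"
      "0 < signed_stretch a (f q u) (f q v) q * signed_stretch a g g q"
      using signed_stretch_same_sign[OF a(1)] that Kq unfolding K_def by auto
    then have "0 < signed_stretch a u v q * signed_stretch a (f q u) (f q v) q"
      by (auto simp: zero_less_mult_iff)
    moreover have "h v - h u = (v - u) * (signed_stretch a v u q * signed_stretch a (f q v) (f q u) q)"
      unfolding hq f_def using funpow_quad_diff[of q a] by simp
    moreover have "signed_stretch a v u q = signed_stretch a u v q" for u v
      by (simp add: signed_stretch_def add.commute)
    ultimately show ?thesis using that(3) by (metis diff_gt_0_iff_gt mult_pos_pos)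
  qed
  have hkK: "(h ^^ k) z \<in> K" if "z \<in> K" for z k by (induction k) (use that hK in auto)
  have hk: "(h ^^ k) z = f (2 * q * k) z" for k z
    by (simp add: h_def f_def funpow_mult mult.commute)
  have q0: "0 < q" using nm by (simp add: q_def)
  \<comment> \<open>Between consecutive times of \<open>h\<close> distances grow at most by
    \<open>4 ^ (2 * q)\<close>, so a pair this close at all times of \<open>h\<close> never reaches
    the length \<open>c\<close> demanded by \<open>long\<close>.\<close>
  have no_short: False if uv: "u \<in> K" "v \<in> K" "u \<noteq> v"
    "\<And>k. \<bar>(h ^^ k) u - (h ^^ k) v\<bar> < c / 4 ^ (2 * q)" for u v
  proof -
    have "same_side a u v"
      using uv strict_side_trans strict_side_sym strict_side_same_side unfolding K_def by blast
    then obtain j where j: "c \<le> \<bar>f j u - f j v\<bar>"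
      using long uv unfolding K_def f_def by blast
    define k r where "k = j div (2 * q)" and "r = j mod (2 * q)"
    have "j = r + 2 * q * k" "r < 2 * q" using q0 by (auto simp: k_def r_def)
    then have "\<bar>f j u - f j v\<bar> = \<bar>f r ((h ^^ k) u) - f r ((h ^^ k) v)\<bar>" by (simp add: fadd hk)
    also have "\<dots> = \<bar>(h ^^ k) u - (h ^^ k) v\<bar> * stretch a ((h ^^ k) u) ((h ^^ k) v) r"
      unfolding f_def using a by (simp add: dist_funpow_quad)
    also have "\<dots> \<le> \<bar>(h ^^ k) u - (h ^^ k) v\<bar> * 4 ^ r"
      using hkK uv unfolding K_def by (intro mult_left_mono stretch_le a) auto
    also have "\<dots> \<le> \<bar>(h ^^ k) u - (h ^^ k) v\<bar> * 4 ^ (2 * q)"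
      using \<open>r < 2 * q\<close> by (intro mult_left_mono power_increasing) auto
    also have "\<dots> < c" using uv(4)[of k] by (simp add: less_divide_eq)
    finally show False using j by simp
  qed
  have gI: "g \<in> {-1..1}"
    using gn fI[OF xy(1), of n] fI[OF xy(2), of n] unfolding strictly_between_def by auto
  have gK: "g \<in> K" unfolding K_def using gI strict_side_interior[OF a(1) ssn gn gn] by simp
  show False
  proof (cases "\<forall>w\<in>K. h w = w")
    case True
    \<comment> \<open>If \<open>h\<close> is the identity on \<open>K\<close>, two points of
      \<open>K\<close> closer than \<open>c / 4 ^ (2 * q)\<close> keep their distance under
      \<open>h\<close>. \<open>v\<close> is such a partner of \<open>g\<close>, taken inside the
      \<open>n\<close>-th image of the homterval.\<close>
    define v where "v = min (g + c / 4 ^ (2 * q) / 2) ((g + max (f n x) (f n y)) / 2)"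
    have c4: "0 < c / 4 ^ (2 * q)" using c by simp
    then have v: "g < v" "v \<le> g + c / 4 ^ (2 * q) / 2" "strictly_between (f n x) (f n y) v"
      using gn unfolding v_def strictly_between_def by (auto simp: min_def)
    have "v \<in> {-1..1}"
      using v(3) fI[OF xy(1), of n] fI[OF xy(2), of n] unfolding strictly_between_def by auto
    then have "v \<in> K" unfolding K_def using strict_side_interior[OF a(1) ssn v(3) gn] by simp
    have "(h ^^ k) w = w" if "w \<in> K" for w k by (induction k) (use that True in auto)
    then show False
      using no_short[of g v] gK \<open>v \<in> K\<close> v(1,2) c4 by auto
  next
    case False
    then obtain w where w: "w \<in> K" "h w \<noteq> w" by auto
    \<comment> \<open>Otherwise \<open>h\<close> moves some \<open>w\<close>. Since \<open>h\<close>
      is increasing, the orbit of \<open>w\<close> is strictly monotone; it is bounded, hence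
      Cauchy, and two consecutive late terms stay close under all iterates of
      \<open>h\<close>.\<close>
    define W where "W k = (h ^^ k) w" for k
    have WK: "W k \<in> K" for k unfolding W_def using hkK w by blast
    have hW: "h (W k) = W (Suc k)" for k by (simp add: W_def)
    have neW: "W k \<noteq> W (Suc k)" for k
    proof (induction k)
      case (Suc k)
      then show ?case using h_mono WK hW by (metis less_irrefl linorder_neqE_linordered_idom)
    qed (use w in \<open>simp add: W_def\<close>)
    have "monoseq W"
    proof (cases "w < h w")
      case True
      have "W k < W (Suc k)" for k
      proof (induction k)
        case (Suc k)
        show ?case using h_mono[OF WK WK Suc] hW by simp
      qed (use True in \<open>simp add: W_def\<close>)
      then show ?thesis by (meson less_imp_le monoI2 mono_SucI1)
    next
      case False
      have "W (Suc k) < W k" for k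
      proof (induction k)
        case (Suc k)
        show ?case using h_mono[OF WK WK Suc] hW by simp
      qed (use False w in \<open>simp add: W_def\<close>)
      then show ?thesis by (meson less_imp_le mono_SucI2)
    qed
    moreover have "\<bar>W k\<bar> \<le> 1" for k using WK[of k] unfolding K_def by auto
    then have "Bseq W" by (intro BseqI'[of _ 1]) auto
    ultimately have "Cauchy W" using Bseq_monoseq_convergent convergent_Cauchy by blast
    then obtain M where M: "\<And>i j. M \<le> i \<Longrightarrow> M \<le> j \<Longrightarrow> dist (W i) (W j) < c / 4 ^ (2 * q)"
      unfolding Cauchy_def using c by (metis divide_pos_pos zero_less_numeral zero_less_power)
    have "(h ^^ k) (W j) = W (k + j)" for k j by (simp add: W_def funpow_add)
    then show False
      using no_short[OF WK WK neW[of M]] M by (auto simp: dist_real_def)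
  qed
qed

subsection \<open>Super-stable parameters near a\<close>

lemma tendsto_funpow_quad:
  assumes "(b \<longlongrightarrow> a) F" "(X \<longlongrightarrow> x) F"
  shows "((\<lambda>n. (quad (b n) ^^ i) (X n)) \<longlongrightarrow> (quad a ^^ i) x) F"
proof (induction i)
  case (Suc i)
  then show ?case unfolding funpow_quad_Suc unfolding quad_def by (intro tendsto_intros assms)
qed (use assms in simp)

text \<open>Compactness: if pairs at distance at least \<open>\<eta>\<close> kept common signs for
  ever longer times at parameters tending to \<open>a\<close>, a limit pair would satisfy
  \<open>same_side a\<close>, because the sign condition is closed, and would still be that far
  apart.\<close>

lemma shadowing:
  assumes no_homterval: "\<forall>x\<in>{-1..1}. \<forall>y\<in>{-1..1}. same_side a x y \<longrightarrow> x = y"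
    and "0 < \<eta>"
  shows "\<exists>N \<rho>. 0 < \<rho> \<and> (\<forall>b b' x y. \<bar>b - a\<bar> < \<rho> \<longrightarrow> \<bar>b' - a\<bar> < \<rho> \<longrightarrow> x \<in> {-1..1} \<longrightarrow> y \<in> {-1..1} \<longrightarrow>
    (\<forall>i\<le>N. 0 \<le> (quad b ^^ i) x * (quad b' ^^ i) y) \<longrightarrow> \<bar>x - y\<bar> < \<eta>)"
proof (rule ccontr)
  assume neg: "\<not> ?thesis"
  define Q where "Q N b b' x y \<longleftrightarrow> \<bar>b - a\<bar> < inverse (real (Suc N)) \<and> \<bar>b' - a\<bar> < inverse (real (Suc N)) \<and>
      x \<in> {-1..1} \<and> y \<in> {-1..1} \<and> (\<forall>i\<le>N. 0 \<le> (quad b ^^ i) x * (quad b' ^^ i) y) \<and> \<not> \<bar>x - y\<bar> < \<eta>"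
    for N b b' x y
  have "\<exists>b b' x y. Q N b b' x y" for N
  proof -
    have "0 < inverse (real (Suc N))" by simp
    then show ?thesis using neg unfolding Q_def by blast
  qed
  then obtain b b' X Y where Q: "\<And>N. Q N (b N) (b' N) (X N) (Y N)" by metis
  have b: "\<bar>b N - a\<bar> < inverse (real (Suc N))" and b': "\<bar>b' N - a\<bar> < inverse (real (Suc N))"
    and XY: "X N \<in> {-1..1}" "Y N \<in> {-1..1}" and far: "\<eta> \<le> \<bar>X N - Y N\<bar>" for N
    using Q[of N] unfolding Q_def not_less by blast+
  have sgn: "0 \<le> (quad (b N) ^^ i) (X N) * (quad (b' N) ^^ i) (Y N)" if "i \<le> N" for N i
    using Q[of N] that unfolding Q_def by blast
  have lim: "c \<longlonglongrightarrow> a" if "\<And>N. \<bar>c N - a\<bar> < inverse (real (Suc N))" for c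
  proof (rule LIM_zero_cancel[OF Lim_null_comparison[OF _ LIMSEQ_inverse_real_of_nat]])
    show "eventually (\<lambda>N. norm (c N - a) \<le> inverse (real (Suc N))) sequentially"
      using that by (intro always_eventually allI) (metis less_imp_le real_norm_def)
  qed
  have "compact ({-1..1::real} \<times> {-1..1::real})" by (intro compact_Times compact_Icc)
  moreover have "\<forall>N. (X N, Y N) \<in> {-1..1} \<times> {-1..1}" using XY by auto
  ultimately obtain l s where l: "l \<in> {-1..1} \<times> {-1..1}" and s: "strict_mono s"
    and lim_l: "((\<lambda>N. (X N, Y N)) \<circ> s) \<longlonglongrightarrow> l"
    unfolding compact_eq_seq_compact_metric seq_compact_def by meson
  define x y where "x = fst l" and "y = snd l"
  have X: "(\<lambda>N. X (s N)) \<longlonglongrightarrow> x" and Y: "(\<lambda>N. Y (s N)) \<longlonglongrightarrow> y"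
    using tendsto_fst[OF lim_l] tendsto_snd[OF lim_l] by (simp_all add: x_def y_def o_def)
  have bs: "(\<lambda>N. b (s N)) \<longlonglongrightarrow> a" "(\<lambda>N. b' (s N)) \<longlonglongrightarrow> a"
    using LIMSEQ_subseq_LIMSEQ[OF lim[OF b] s] LIMSEQ_subseq_LIMSEQ[OF lim[OF b'] s]
    by (simp_all add: o_def)
  have "0 \<le> (quad a ^^ i) x * (quad a ^^ i) y" for i
  proof (rule LIMSEQ_le_const)
    show "(\<lambda>N. (quad (b (s N)) ^^ i) (X (s N)) * (quad (b' (s N)) ^^ i) (Y (s N)))
        \<longlonglongrightarrow> (quad a ^^ i) x * (quad a ^^ i) y"
      by (intro tendsto_mult tendsto_funpow_quad bs X Y)
    show "\<exists>M. \<forall>N\<ge>M. 0 \<le> (quad (b (s N)) ^^ i) (X (s N)) * (quad (b' (s N)) ^^ i) (Y (s N))"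
      using sgn seq_suble[OF s] order_trans by blast
  qed
  then have "x = y"
    using no_homterval l unfolding same_side_def x_def y_def by (auto simp: mem_Times_iff)
  moreover have "\<eta> \<le> \<bar>x - y\<bar>"
    by (rule LIMSEQ_le_const[OF tendsto_rabs[OF tendsto_diff[OF X Y]]]) (use far in auto)
  ultimately show False using \<open>0 < \<eta>\<close> by simp
qed

section \<open>Sign changes of the critical orbit over parameter intervals\<close>

lemma continuous_on_xi [continuous_intros]: "continuous_on A (\<xi> n)"
  unfolding \<xi>_def by (intro continuous_intros)

lemma xi_in_I: "0 < b \<Longrightarrow> b \<le> 2 \<Longrightarrow> \<xi> n b \<in> {-1..1}"
  unfolding \<xi>_def by (intro funpow_quad_in_I) auto

lemma funpow_xi: "(quad b ^^ i) (\<xi> n b) = \<xi> (i + n) b"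
  by (simp add: \<xi>_def funpow_add)

lemma same_sign_on_interval:
  fixes f :: "real \<Rightarrow> real"
  assumes "is_interval C" "continuous_on C f" "\<And>z. z \<in> C \<Longrightarrow> f z \<noteq> 0" "x \<in> C" "y \<in> C"
  shows "0 < f x * f y"
proof (rule ccontr)
  assume "\<not> ?thesis"
  then have "f x \<le> 0 \<and> 0 \<le> f y \<or> f y \<le> 0 \<and> 0 \<le> f x"
    using assms(3)[OF assms(4)] assms(3)[OF assms(5)] by (auto simp: zero_less_mult_iff)
  moreover have "is_interval (f ` C)"
    using assms(1,2) by (simp add: is_interval_connected_1 connected_continuous_image)
  ultimately have "0 \<in> f ` C" using assms(4,5) unfolding is_interval_1 by blast
  then show False using assms(3) by auto
qed

lemma (in benedicks_carleson) cell_props: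
  assumes "a \<in> (\<Inter>n. A n)"
  shows "a \<in> cell (P n) a" "cell (P n) a \<subseteq> {a\<^sub>0..2}" "is_interval (cell (P n) a)"
proof -
  have "a \<in> A n" using assms by auto
  then obtain w where w: "w \<in> P n" "a \<in> w"
    using partition[of n] by (auto simp: partition_on_def)
  have "cell (P n) a = w"
    unfolding cell_def
  proof (rule the_equality)
    fix v assume "v \<in> P n \<and> a \<in> v"
    then show "v = w" using w partition[of n] by (auto simp: partition_on_def disjoint_def)
  qed (use w in simp)
  moreover have "w \<subseteq> A n" using partition[of n] w by (auto simp: partition_on_def)
  ultimately show "a \<in> cell (P n) a" "cell (P n) a \<subseteq> {a\<^sub>0..2}" "is_interval (cell (P n) a)"
    using w nbhd[of n] intervals[of w n] by auto
qed

lemma (in benedicks_carleson) cells_shrink: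
  assumes "a \<in> (\<Inter>n. A n)" "0 < e"
  shows "\<exists>n. cell (P n) a \<subseteq> {a - e<..<a + e}"
proof -
  have "a + e \<notin> (\<Inter>n. cell (P n) a)" "a - e \<notin> (\<Inter>n. cell (P n) a)"
    using shrinking[OF assms(1)] assms(2) by auto
  then obtain n m where "a + e \<notin> cell (P n) a" "a - e \<notin> cell (P m) a" by blast
  moreover have "a \<in> A (max n m)" using assms(1) by blast
  ultimately have nin: "a + e \<notin> cell (P (max n m)) a" "a - e \<notin> cell (P (max n m)) a"
    using nested[of a "max n m"] by (auto simp: subset_iff)
  have "x \<in> {a - e<..<a + e}" if "x \<in> cell (P (max n m)) a" for x
  proof (rule ccontr)
    assume "x \<notin> {a - e<..<a + e}"
    then have "a \<le> a + e \<and> a + e \<le> x \<or> x \<le> a - e \<and> a - e \<le> a" using assms(2) by auto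
    then show False
      using nin that cell_props(1,3)[OF assms(1), of "max n m"] unfolding is_interval_1 by blast
  qed
  then show ?thesis by blast
qed

text \<open>If the critical orbit had no zeros over a small cell, all parameters of the cell would
  share all signs, and shadowing would confine its image at an escape time to length
  \<open>\<delta> / 2\<close>. An escape demands at least \<open>\<delta>\<close>.\<close>

lemma (in benedicks_carleson) critical_orbit_zeros_accumulate:
  assumes a: "a \<in> (\<Inter>n. A n)" and pos: "0 < a\<^sub>0" "0 < \<delta>" and e: "0 < e"
    and no_homterval: "\<forall>x\<in>{-1..1}. \<forall>y\<in>{-1..1}. same_side a x y \<longrightarrow> x = y"
  shows "\<exists>b\<in>{0<..2}. \<exists>j>0. \<bar>b - a\<bar> < e \<and> \<xi> j b = 0"
proof (rule ccontr)
  assume nz: "\<not> ?thesis"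
  have "0 < \<delta> / 4" using pos by simp
  from shadowing[OF no_homterval this] obtain N \<rho> where "0 < \<rho>" and
    "\<forall>b b' x y. \<bar>b - a\<bar> < \<rho> \<longrightarrow> \<bar>b' - a\<bar> < \<rho> \<longrightarrow> x \<in> {-1..1} \<longrightarrow> y \<in> {-1..1} \<longrightarrow>
      (\<forall>i\<le>N. 0 \<le> (quad b ^^ i) x * (quad b' ^^ i) y) \<longrightarrow> \<bar>x - y\<bar> < \<delta> / 4"
    by blast
  note sh = this(2)[rule_format]
  obtain n where n: "cell (P n) a \<subseteq> {a - min e \<rho><..<a + min e \<rho>}"
    using cells_shrink[OF a, of "min e \<rho>"] e \<open>0 < \<rho>\<close> by auto
  \<comment> \<open>Since \<open>k \<le> ret a k\<close>, an index above \<open>n + 1\<close> makes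
    the cell one step before the escape lie within the small neighbourhood of
    \<open>a\<close>.\<close>
  obtain k where k: "n + 1 < k" "escape_time \<delta> (\<lambda>n. cell (P n) a) (ret a k)"
    using infinitely_many_escapes[OF a] unfolding infinite_nat_iff_unbounded by blast
  have "k \<le> ret a k" using seq_suble[OF ret_increasing[OF a]] .
  define r where "r = ret a k"
  define C where "C = cell (P (r - 1)) a"
  have r: "n \<le> r - 1" "0 < r" using k \<open>k \<le> ret a k\<close> by (auto simp: r_def)
  have C: "a \<in> C" "C \<subseteq> {a\<^sub>0..2}" "is_interval C" using cell_props[OF a] by (auto simp: C_def)
  have "a \<in> A (r - 1)" using a by blast
  then have Cn: "C \<subseteq> {a - min e \<rho><..<a + min e \<rho>}" using nested[OF _ r(1)] n unfolding C_def by blast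
  have close: "\<bar>\<xi> r b - \<xi> r a\<bar> < \<delta> / 4" if "b \<in> C" for b
  proof (rule sh)
    show "\<bar>b - a\<bar> < \<rho>" "\<bar>a - a\<bar> < \<rho>"
      using subsetD[OF Cn that] \<open>0 < \<rho>\<close> by (auto simp: abs_less_iff)
    show "\<xi> r b \<in> {-1..1}" "\<xi> r a \<in> {-1..1}" using that C pos xi_in_I[of b r] xi_in_I[of a r] by (auto simp: subset_iff)
    fix i
    have "\<xi> (i + r) z \<noteq> 0" if "z \<in> C" for z
    proof -
      have "\<bar>z - a\<bar> < e" "z \<in> {0<..2}"
        using subsetD[OF Cn that] subsetD[OF C(2) that] pos by (auto simp: abs_less_iff)
      then show ?thesis using nz r(2) by blast
    qed
    then have "0 < \<xi> (i + r) b * \<xi> (i + r) a"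
      using same_sign_on_interval[OF C(3) _ _ that C(1), of "\<xi> (i + r)"] continuous_on_xi by blast
    then show "0 \<le> (quad b ^^ i) (\<xi> r b) * (quad a ^^ i) (\<xi> r a)" by (simp add: funpow_xi)
  qed
  have "\<xi> r ` C \<subseteq> {\<xi> r a - \<delta>/4..\<xi> r a + \<delta>/4}"
  proof (rule image_subsetI)
    show "\<xi> r b \<in> {\<xi> r a - \<delta>/4..\<xi> r a + \<delta>/4}" if "b \<in> C" for b
      using close[OF that] unfolding atLeastAtMost_iff abs_less_iff by argo
  qed
  have "measure lborel (\<xi> r ` C) \<le> \<delta> / 2"
  proof (cases "\<xi> r ` C \<in> sets lborel")
    case True
    have "measure lborel (\<xi> r ` C) \<le> measure lborel {\<xi> r a - \<delta>/4..\<xi> r a + \<delta>/4}"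
      by (intro measure_mono_fmeasurable True \<open>\<xi> r ` C \<subseteq> _\<close>) (use pos in \<open>simp add: fmeasurable_def\<close>)
    then show ?thesis using pos by simp
  next
    \<comment> \<open>On non-measurable sets \<open>measure\<close> has the default value 0.\<close>
    case False
    then show ?thesis using pos by (simp add: measure_notin_sets)
  qed
  moreover have "\<delta> \<le> measure lborel (\<xi> r ` C)"
    using k(2) by (simp add: escape_time_def r_def C_def)
  ultimately show False using pos by simp
qed

text \<open>Take the zero \<open>b\<close> closest to \<open>a\<close> on a segment starting at
  \<open>a\<close>, and the least positive time \<open>r\<close> at which it is a zero. Before time
  \<open>r\<close> no zero can lie on the segment from \<open>a\<close> to \<open>b\<close>, so the
  signs at \<open>b\<close> and \<open>a\<close> agree.\<close>

lemma superstable_parameter_near: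
  assumes zeros: "\<And>e. 0 < e \<Longrightarrow> \<exists>b\<in>{0<..2}. \<exists>j>0. \<bar>b - a\<bar> < e \<and> \<xi> j b = 0"
    and nz: "\<And>j. 0 < j \<Longrightarrow> \<xi> j a \<noteq> 0" and a: "a \<in> {0<..2}" and e: "0 < e"
  shows "\<exists>b r. b \<in> {0<..2} \<and> N < r \<and> \<bar>b - a\<bar> < e \<and> \<xi> r b = 0 \<and>
    (\<forall>i. 0 < i \<and> i < r \<longrightarrow> 0 < \<xi> i b * \<xi> i a)"
proof -
  have "eventually (\<lambda>b. \<xi> j b \<noteq> 0) (nhds a)" if "0 < j" for j
  proof -
    have "(\<xi> j \<longlongrightarrow> \<xi> j a) (nhds a)"
      using continuous_on_xi[of UNIV j]
      by (simp add: continuous_on_eq_continuous_at isCont_def tendsto_at_iff_tendsto_nhds)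
    then show ?thesis using nz[OF that] by (rule tendsto_imp_eventually_ne)
  qed
  \<comment> \<open>Excluding zeros of the first \<open>N\<close> functions near \<open>a\<close>
    forces the period above \<open>N\<close>.\<close>
  then have "eventually (\<lambda>b. \<forall>j\<in>{1..N}. \<xi> j b \<noteq> 0) (nhds a)"
    by (intro eventually_ball_finite) auto
  then obtain d where d: "0 < d" "\<And>b j. \<bar>b - a\<bar> < d \<Longrightarrow> j \<in> {1..N} \<Longrightarrow> \<xi> j b \<noteq> 0"
    unfolding eventually_nhds_metric dist_real_def by blast
  obtain b0 j0 where b0: "b0 \<in> {0<..2}" "\<bar>b0 - a\<bar> < min d e" "0 < j0" "\<xi> j0 b0 = 0"
    using zeros[of "min d e"] d e by auto
  define Z where "Z = (\<Union>j\<in>{1..j0}. closed_segment a b0 \<inter> \<xi> j -` {0})"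
  have "closed (\<xi> j -` {0})" for j
    using continuous_closed_vimage[of "{0}" "\<xi> j"] continuous_on_xi[of UNIV j]
    by (simp add: continuous_on_eq_continuous_at)
  then have "compact Z" unfolding Z_def by (intro compact_UN compact_Int_closed) auto
  moreover have "b0 \<in> Z" using b0 by (auto simp: Z_def)
  ultimately obtain b where b: "b \<in> Z" and closest: "\<And>b'. b' \<in> Z \<Longrightarrow> \<bar>b - a\<bar> \<le> \<bar>b' - a\<bar>"
    using continuous_attains_inf[of Z "\<lambda>b. \<bar>b - a\<bar>"] continuous_on_dist[OF continuous_on_id continuous_on_const, of Z a]
    unfolding dist_real_def by blast
  obtain j1 where j1: "j1 \<in> {1..j0}" "\<xi> j1 b = 0" and bseg: "b \<in> closed_segment a b0"
    using b by (auto simp: Z_def)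
  define r where "r = (LEAST j. 0 < j \<and> \<xi> j b = 0)"
  have r: "0 < r" "\<xi> r b = 0"
    using LeastI[of "\<lambda>j. 0 < j \<and> \<xi> j b = 0" j1] j1 unfolding r_def by auto
  have "r \<le> j1" unfolding r_def using j1 by (intro Least_le) auto
  have rmin: "\<xi> i b \<noteq> 0" if "0 < i" "i < r" for i
    using not_less_Least[of i "\<lambda>j. 0 < j \<and> \<xi> j b = 0"] that unfolding r_def by auto
  have bI: "b \<in> {0<..2}"
    using bseg a b0(1) by (auto simp: closed_segment_eq_real_ivl split: if_splits)
  have bd: "\<bar>b - a\<bar> < min d e" using closest[OF \<open>b0 \<in> Z\<close>] b0(2) by simp
  have "N < r"
  proof (rule ccontr)
    assume "\<not> N < r"
    then show False using d(2)[of b r] bd r by auto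
  qed
  moreover have "0 < \<xi> i b * \<xi> i a" if i: "0 < i" "i < r" for i
  proof (rule same_sign_on_interval[where C = "closed_segment a b" and f = "\<xi> i"])
    show "\<xi> i z \<noteq> 0" if z: "z \<in> closed_segment a b" for z
    proof
      assume "\<xi> i z = 0"
      moreover have "z \<in> closed_segment a b0" using z bseg subset_closed_segment by blast
      ultimately have "z \<in> Z" using i \<open>r \<le> j1\<close> j1 by (auto simp: Z_def)
      then have "\<bar>b - a\<bar> \<le> \<bar>z - a\<bar>" by (rule closest)
      then have "z = b" using z by (auto simp: closed_segment_eq_real_ivl split: if_splits)
      then show False using rmin[OF i] \<open>\<xi> i z = 0\<close> by simp
    qed
    show "is_interval (closed_segment a b)" by (simp add: is_interval_connected_1)
  qed (auto intro: continuous_on_xi)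
  ultimately show ?thesis using bI bd r by (intro exI[of _ b] exI[of _ r]) auto
qed

subsection \<open>Convergence of the orbit measures\<close>

lemma prime_period_critical:
  assumes "0 < r" "\<xi> r b = 0" "\<And>i. 0 < i \<Longrightarrow> i < r \<Longrightarrow> \<xi> i b \<noteq> 0"
  shows "prime_period (quad b) 0 r"
  using assms by (simp add: prime_period_def \<xi>_def)

lemma super_stable_critical:
  assumes "prime_period (quad b) 0 r"
  shows "super_stable b r ((\<lambda>k. \<xi> k b) ` {..<r})"
proof -
  have "0 < r" using assms by (simp add: prime_period_def)
  then have "(0::real) \<in> (\<lambda>k. (quad b ^^ k) 0) ` {..<r}" by (intro image_eqI[of _ _ 0]) auto
  moreover have "(0::real) \<in> {-1..1}" by simp
  ultimately show ?thesis
    using assms unfolding super_stable_def periodic_orbit_def \<xi>_def by blast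
qed

text \<open>Equality at times \<open>i < j\<close> would, after \<open>r - j\<close> more steps,
  bring 0 back at the time \<open>r - j + i < r\<close>. Injectivity turns the uniform measure on
  the orbit set into a time average.\<close>

lemma inj_on_xi:
  assumes "prime_period (quad b) 0 r"
  shows "inj_on (\<lambda>k. \<xi> k b) {..<r}"
proof (rule linorder_inj_onI)
  fix i j assume "i < j" and ij: "i \<in> {..<r}" "j \<in> {..<r}"
  show "\<xi> i b \<noteq> \<xi> j b"
  proof
    assume "\<xi> i b = \<xi> j b"
    then have "(quad b ^^ (r - j)) (\<xi> i b) = (quad b ^^ (r - j)) (\<xi> j b)" by simp
    then have "\<xi> (r - j + i) b = \<xi> r b" using ij by (simp add: funpow_xi)
    moreover have "0 < r - j + i" "r - j + i < r" using \<open>i < j\<close> ij by auto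
    ultimately show False using assms unfolding prime_period_def \<xi>_def by auto
  qed
qed auto

lemma integral_orbit_measure:
  assumes "prime_period (quad b) 0 r" "0 < b" "b \<le> 2" "continuous_on {-1..1} \<phi>"
  shows "(\<integral>x. \<phi> x \<partial>orbit_measure ((\<lambda>k. \<xi> k b) ` {..<r})) = (\<Sum>k<r. \<phi> (\<xi> k b)) / r"
proof -
  have "(\<lambda>x. x) ` (\<lambda>k. \<xi> k b) ` {..<r} \<subseteq> {-1..1}" using xi_in_I[OF assms(2,3)] by blast
  then show ?thesis
    unfolding orbit_measure_def using inj_on_xi[OF assms(1)] assms(4)
    by (simp add: integral_distr_uniform_count_measure sum.reindex card_image)
qed

lemma integral_empirical:
  assumes "0 < a" "a \<le> 2" "continuous_on {-1..1} \<phi>"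
  shows "(\<integral>x. \<phi> x \<partial>empirical a 0 n) = (\<Sum>k<n. \<phi> (\<xi> k a)) / n"
proof -
  have "(\<lambda>k. (quad a ^^ k) 0) ` {..<n} \<subseteq> {-1..1}"
    using xi_in_I[OF assms(1,2)] unfolding \<xi>_def by blast
  then show ?thesis
    unfolding empirical_def using assms(3)
    by (simp add: integral_distr_uniform_count_measure \<xi>_def)
qed

text \<open>The last \<open>N\<close> terms get only the trivial bound: shadowing controls a time
  \<open>k\<close> only if the signs still agree for \<open>N\<close> steps after it.\<close>

lemma abs_sum_diff_le:
  fixes u v :: "nat \<Rightarrow> real" and \<epsilon> B :: real and N r :: nat
  assumes "\<And>k. k + N < r \<Longrightarrow> \<bar>u k - v k\<bar> \<le> \<epsilon>" "\<And>k. \<bar>u k - v k\<bar> \<le> B" "0 \<le> \<epsilon>" "0 \<le> B"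
  shows "\<bar>(\<Sum>k<r. u k) - (\<Sum>k<r. v k)\<bar> \<le> r * \<epsilon> + N * B"
proof -
  have "\<bar>(\<Sum>k<r. u k) - (\<Sum>k<r. v k)\<bar> = \<bar>\<Sum>k<r. u k - v k\<bar>" by (simp add: sum_subtractf)
  also have "\<dots> \<le> (\<Sum>k<r. \<bar>u k - v k\<bar>)" by (rule sum_abs)
  also have "\<dots> \<le> (\<Sum>k<r. \<epsilon> + (if k \<in> {r - N..<r} then B else 0))"
    by (intro sum_mono) (use assms in \<open>auto intro: add_increasing\<close>)
  also have "\<dots> = r * \<epsilon> + card ({..<r} \<inter> {r - N..<r}) * B"
    unfolding sum.distrib by (simp add: sum.inter_restrict[symmetric] del: atLeastLessThan_iff)
  also have "{..<r} \<inter> {r - N..<r} = {r - N..<r}" by auto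
  also have "r * \<epsilon> + card {r - N..<r} * B \<le> r * \<epsilon> + N * B"
    using assms(4) by (intro add_left_mono mult_right_mono) auto
  finally show ?thesis .
qed

text \<open>The critical orbits of \<open>b n\<close> and \<open>a\<close> share signs before the
  period ends, so they are close except at the last \<open>N\<close> times, whose weight in the
  averages vanishes as \<open>r n\<close> grows. Genericity is used along the times
  \<open>r n\<close>.\<close>

lemma orbit_measures_converge:
  assumes no_homterval: "\<forall>x\<in>{-1..1}. \<forall>y\<in>{-1..1}. same_side a x y \<longrightarrow> x = y"
    and a: "0 < a" "a \<le> 2" and b: "\<And>n. b n \<in> {0<..2}" "b \<longlonglongrightarrow> a"
    and r: "filterlim r at_top sequentially" and per: "\<And>n. prime_period (quad (b n)) 0 (r n)"
    and sgn: "\<And>n i. 0 < i \<Longrightarrow> i < r n \<Longrightarrow> 0 < \<xi> i (b n) * \<xi> i a"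
    and gen: "generic a 0 M"
  shows "weak_star_lim (\<lambda>n. orbit_measure ((\<lambda>k. \<xi> k (b n)) ` {..<r n})) M"
  unfolding weak_star_lim_def
proof (intro allI impI)
  fix \<phi> :: "real \<Rightarrow> real" assume \<phi>: "continuous_on {-1..1} \<phi>"
  define E where "E n = (\<Sum>k<r n. \<phi> (\<xi> k a)) / r n" for n
  define F where "F n = (\<Sum>k<r n. \<phi> (\<xi> k (b n))) / r n" for n
  have "(\<lambda>n. \<integral>x. \<phi> x \<partial>empirical a 0 n) \<longlonglongrightarrow> (\<integral>x. \<phi> x \<partial>M)"
    using gen \<phi> unfolding generic_def weak_star_lim_def by blast
  then have "(\<lambda>n. \<integral>x. \<phi> x \<partial>empirical a 0 (r n)) \<longlonglongrightarrow> (\<integral>x. \<phi> x \<partial>M)"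
    by (rule filterlim_compose[OF _ r])
  then have E: "E \<longlonglongrightarrow> (\<integral>x. \<phi> x \<partial>M)"
    by (simp add: integral_empirical[OF a \<phi>] E_def[abs_def])
  have I: "\<xi> k (b n) \<in> {-1..1}" "\<xi> k a \<in> {-1..1}" for k n
    using xi_in_I b(1)[of n] a by auto
  have "bounded (\<phi> ` {-1..1})"
    by (intro compact_imp_bounded compact_continuous_image \<phi> compact_Icc)
  then obtain B where B: "0 < B" "\<And>x. x \<in> {-1..1} \<Longrightarrow> \<bar>\<phi> x\<bar> \<le> B"
    unfolding bounded_pos by auto
  have FE: "(\<lambda>n. F n - E n) \<longlonglongrightarrow> 0"
  proof (rule LIMSEQ_I)
    fix \<epsilon> :: real assume "0 < \<epsilon>"
    then have "0 < \<epsilon>/2" by simp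
    moreover have "uniformly_continuous_on {-1..1} \<phi>"
      by (rule compact_uniformly_continuous[OF \<phi> compact_Icc])
    ultimately obtain \<eta> where \<eta>: "0 < \<eta>"
      "\<And>x y. x \<in> {-1..1} \<Longrightarrow> y \<in> {-1..1} \<Longrightarrow> \<bar>x - y\<bar> < \<eta> \<Longrightarrow> \<bar>\<phi> x - \<phi> y\<bar> < \<epsilon>/2"
      unfolding uniformly_continuous_on_def dist_real_def by metis
    obtain N \<rho> where "0 < \<rho>" and
      "\<forall>b b' x y. \<bar>b - a\<bar> < \<rho> \<longrightarrow> \<bar>b' - a\<bar> < \<rho> \<longrightarrow> x \<in> {-1..1} \<longrightarrow> y \<in> {-1..1} \<longrightarrow>
        (\<forall>i\<le>N. 0 \<le> (quad b ^^ i) x * (quad b' ^^ i) y) \<longrightarrow> \<bar>x - y\<bar> < \<eta>"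
      using shadowing[OF no_homterval \<eta>(1)] by blast
    note sh = this(2)[rule_format]
    obtain n1 where n1: "\<And>n. n1 \<le> n \<Longrightarrow> \<bar>b n - a\<bar> < \<rho>"
      using LIMSEQ_D[OF b(2) \<open>0 < \<rho>\<close>] by auto
    \<comment> \<open>\<open>R\<close> is chosen so that \<open>N\<close> uncontrolled terms of size
      at most \<open>2 * B\<close> contribute less than \<open>\<epsilon>/2\<close> to an average
      over more than \<open>R\<close> terms.\<close>
    obtain R :: nat where R: "N * (2 * B) < R * (\<epsilon>/2)"
      using reals_Archimedean3[OF \<open>0 < \<epsilon>/2\<close>] by blast
    obtain n2 where n2: "\<And>n. n2 \<le> n \<Longrightarrow> Suc R \<le> r n"
      using r unfolding filterlim_at_top eventually_sequentially by meson
    show "\<exists>n0. \<forall>n\<ge>n0. norm (F n - E n - 0) < \<epsilon>"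
    proof (intro exI[of _ "max n1 n2"] allI impI)
      fix n assume "max n1 n2 \<le> n"
      then have n: "\<bar>b n - a\<bar> < \<rho>" "R < r n" using n1 n2[of n] by auto
      have "\<bar>(\<Sum>k<r n. \<phi> (\<xi> k (b n))) - (\<Sum>k<r n. \<phi> (\<xi> k a))\<bar> \<le> r n * (\<epsilon>/2) + N * (2 * B)"
      proof (rule abs_sum_diff_le)
        show "\<bar>\<phi> (\<xi> k (b n)) - \<phi> (\<xi> k a)\<bar> \<le> 2 * B" for k
          using B(2)[OF I(1)[of k n]] B(2)[OF I(2)[of k]] by linarith
        show "\<bar>\<phi> (\<xi> k (b n)) - \<phi> (\<xi> k a)\<bar> \<le> \<epsilon>/2" if k: "k + N < r n" for k
        \<comment> \<open>\<open>sgn\<close> starts at time 1; at time 0 both orbits are at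
          0.\<close>
        proof (cases "k = 0")
          case True
          then show ?thesis using \<open>0 < \<epsilon>/2\<close> by (simp add: \<xi>_def)
        next
          case False
          have "\<bar>\<xi> k (b n) - \<xi> k a\<bar> < \<eta>"
          proof (rule sh[OF n(1) _ I])
            show "0 \<le> (quad (b n) ^^ i) (\<xi> k (b n)) * (quad a ^^ i) (\<xi> k a)" if "i \<le> N" for i
              using sgn[of "i + k" n] False k that by (simp add: funpow_xi)
          qed (use \<open>0 < \<rho>\<close> in simp)
          then show ?thesis using \<eta>(2)[OF I] by (simp add: less_imp_le)
        qed
      qed (use \<open>0 < \<epsilon>/2\<close> B(1) in simp_all)
      also have "\<dots> < r n * (\<epsilon>/2) + r n * (\<epsilon>/2)"
        using R mult_strict_right_mono[of "real R" "real (r n)" "\<epsilon>/2"] n(2) \<open>0 < \<epsilon>/2\<close> by linarith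
      also have "\<dots> = r n * \<epsilon>" by simp
      finally have "\<bar>(\<Sum>k<r n. \<phi> (\<xi> k (b n))) - (\<Sum>k<r n. \<phi> (\<xi> k a))\<bar> < r n * \<epsilon>" .
      moreover have "F n - E n = ((\<Sum>k<r n. \<phi> (\<xi> k (b n))) - (\<Sum>k<r n. \<phi> (\<xi> k a))) / r n"
        by (simp add: F_def E_def diff_divide_distrib)
      ultimately show "norm (F n - E n - 0) < \<epsilon>"
        using n(2) by (simp add: abs_divide divide_less_eq mult.commute)
    qed
  qed
  have "(\<integral>x. \<phi> x \<partial>orbit_measure ((\<lambda>k. \<xi> k (b n)) ` {..<r n})) = F n" for n
    using integral_orbit_measure[OF per _ _ \<phi>] b(1)[of n] by (simp add: F_def)
  then show "(\<lambda>n. \<integral>x. \<phi> x \<partial>orbit_measure ((\<lambda>k. \<xi> k (b n)) ` {..<r n})) \<longlonglongrightarrow> (\<integral>x. \<phi> x \<partial>M)"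
    using Lim_transform[OF E FE] by simp
qed

section \<open>The approximating sequence and the choice of the constants\<close>

lemma has_field_derivative_funpow_quad:
  "((quad a ^^ n) has_field_derivative (\<Prod>i<n. - (2 * a * (quad a ^^ i) x))) (at x)"
proof (induction n)
  case (Suc n)
  have "(quad a has_field_derivative - (2 * a * y)) (at y)" for y
    unfolding quad_def[abs_def] by (auto intro!: derivative_eq_intros)
  from DERIV_chain2[OF this Suc]
  show ?case by (simp add: o_def mult.commute)
qed (simp add: id_def)

lemma abs_deriv_critical_value:
  assumes "0 < a"
  shows "\<bar>deriv (quad a ^^ n) (quad a 0)\<bar> = (\<Prod>i<n. 2 * a * \<bar>(quad a ^^ Suc i) 0\<bar>)"
  using assms
  by (simp add: DERIV_imp_deriv[OF has_field_derivative_funpow_quad] abs_prod abs_mult funpow_swap1)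

lemma (in benedicks_carleson) superstable_approximation:
  assumes a: "a \<in> (\<Inter>n. A n)" and pos: "0 < a\<^sub>0" "0 < \<delta>"
    and no_homterval: "\<forall>x\<in>{-1..1}. \<forall>y\<in>{-1..1}. same_side a x y \<longrightarrow> x = y"
  shows "\<exists>(as :: nat \<Rightarrow> real) (r :: nat \<Rightarrow> nat) (S :: nat \<Rightarrow> real set).
         (\<forall>n. as n \<in> {0<..2} \<and> super_stable (as n) (r n) (S n)) \<and>
         as \<longlonglongrightarrow> a \<and>
         incseq r \<and> filterlim r at_top sequentially \<and>
         (\<forall>M. acip a M \<and> generic a 0 M \<longrightarrow> weak_star_lim (\<lambda>n. orbit_measure (S n)) M)"
proof -
  have aI: "a \<in> {0<..2}" using a nbhd[of 0] pos by auto
  have nz: "\<xi> j a \<noteq> 0" if "0 < j" for j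
  proof -
    have "exp (- \<alpha> * j) \<le> \<bar>\<xi> j a\<bar>"
      unfolding \<xi>_def using slow_recurrence[of a j j] a that by (auto simp: Suc_le_eq)
    then show ?thesis using exp_gt_zero[of "- \<alpha> * j"] by linarith
  qed
  define Q where "Q n b r \<longleftrightarrow> b \<in> {0<..2} \<and> n < r \<and> \<bar>b - a\<bar> < inverse (real (Suc n)) \<and> \<xi> r b = 0 \<and>
    (\<forall>i. 0 < i \<and> i < r \<longrightarrow> 0 < \<xi> i b * \<xi> i a)" for n b r
  have near: "\<exists>b r. b \<in> {0<..2} \<and> N < r \<and> \<bar>b - a\<bar> < e \<and> \<xi> r b = 0 \<and>
      (\<forall>i. 0 < i \<and> i < r \<longrightarrow> 0 < \<xi> i b * \<xi> i a)" if "0 < e" for N e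
    using critical_orbit_zeros_accumulate[OF a pos _ no_homterval] nz aI that
    by (rule superstable_parameter_near)
  \<comment> \<open>Each new period is chosen above both the index and its predecessor, so that the
    periods increase strictly.\<close>
  have "\<exists>f. \<forall>n. Q n (fst (f n)) (snd (f n)) \<and> snd (f n) < snd (f (Suc n))"
  proof (rule dependent_nat_choice)
    show "\<exists>x. Q 0 (fst x) (snd x)" using near[of 1 0] by (auto simp: Q_def)
    fix x n assume "Q n (fst x) (snd x)"
    obtain b r where "b \<in> {0<..2} \<and> max (Suc n) (snd x) < r \<and> \<bar>b - a\<bar> < inverse (real (Suc (Suc n))) \<and> \<xi> r b = 0 \<and>
      (\<forall>i. 0 < i \<and> i < r \<longrightarrow> 0 < \<xi> i b * \<xi> i a)"
      using near[of "inverse (real (Suc (Suc n)))" "max (Suc n) (snd x)"] by auto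
    then have "Q (Suc n) (fst (b, r)) (snd (b, r)) \<and> snd x < snd (b, r)" by (auto simp: Q_def)
    then show "\<exists>y. Q (Suc n) (fst y) (snd y) \<and> snd x < snd y" by blast
  qed
  then obtain f where f: "\<And>n. Q n (fst (f n)) (snd (f n))" "\<And>n. snd (f n) < snd (f (Suc n))" by blast
  define b r where "b n = fst (f n)" and "r n = snd (f n)" for n
  have b: "b n \<in> {0<..2}" "\<bar>b n - a\<bar> < inverse (real (Suc n))" for n
    using f(1)[of n] by (auto simp: Q_def b_def)
  have sgn: "0 < \<xi> i (b n) * \<xi> i a" if "0 < i" "i < r n" for i n
    using f(1)[of n] that by (auto simp: Q_def b_def r_def)
  have r: "n < r n" "\<xi> (r n) (b n) = 0" for n
    using f(1)[of n] by (auto simp: Q_def b_def r_def)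
  have per: "prime_period (quad (b n)) 0 (r n)" for n
  proof (rule prime_period_critical)
    show "\<xi> i (b n) \<noteq> 0" if "0 < i" "i < r n" for i using sgn[OF that] by auto
  qed (use r[of n] in auto)
  have "b \<longlonglongrightarrow> a"
  proof (rule LIM_zero_cancel[OF Lim_null_comparison[OF _ LIMSEQ_inverse_real_of_nat]])
    show "eventually (\<lambda>n. norm (b n - a) \<le> inverse (real (Suc n))) sequentially"
      using b(2) by (intro always_eventually allI) (metis less_imp_le real_norm_def)
  qed
  moreover have mono: "strict_mono r" using f(2) by (simp add: strict_mono_Suc_iff r_def)
  moreover have lim_r: "filterlim r at_top sequentially" by (rule filterlim_subseq[OF mono])
  moreover have "super_stable (b n) (r n) ((\<lambda>k. \<xi> k (b n)) ` {..<r n})" for n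
    by (rule super_stable_critical[OF per])
  moreover have "weak_star_lim (\<lambda>n. orbit_measure ((\<lambda>k. \<xi> k (b n)) ` {..<r n})) M"
    if "generic a 0 M" for M
    using aI by (intro orbit_measures_converge[OF no_homterval _ _ b(1) \<open>b \<longlonglongrightarrow> a\<close> lim_r per sgn that]) auto
  ultimately show ?thesis
    using b(1) strict_mono_mono[OF mono]
    by (intro exI[of _ b] exI[of _ r] exI[of _ "\<lambda>n. (\<lambda>k. \<xi> k (b n)) ` {..<r n}"]) blast
qed

text \<open>The nested filters express "sufficiently small" for constants chosen one after another:
  \<open>\<alpha>\<close> against \<open>\<Lambda>\<close>, then \<open>\<delta>\<close> against
  both, then the parameter neighbourhood of 2 against \<open>\<delta>\<close>.\<close>

theorem theoremA:
  fixes \<Lambda> :: real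
  assumes "0 < \<Lambda>"
  shows "\<forall>\<^sub>F \<alpha> in at_right 0. \<forall>\<^sub>F \<delta> in at_right 0. \<forall>\<^sub>F a\<^sub>0 in at_left 2.
    \<forall>A P ret. benedicks_carleson \<Lambda> \<alpha> \<delta> a\<^sub>0 A P ret \<longrightarrow>
      (\<forall>a \<in> (\<Inter>n. A n). \<exists>(as :: nat \<Rightarrow> real) (r :: nat \<Rightarrow> nat) (S :: nat \<Rightarrow> real set).
         (\<forall>n. as n \<in> {0<..2} \<and> super_stable (as n) (r n) (S n)) \<and>
         as \<longlonglongrightarrow> a \<and>
         incseq r \<and> filterlim r at_top sequentially \<and>
         (\<forall>M. acip a M \<and> generic a 0 M \<longrightarrow> weak_star_lim (\<lambda>n. orbit_measure (S n)) M))"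
proof -
  have "\<forall>\<^sub>F \<alpha> in at_right 0. \<alpha> \<in> {0<..<\<Lambda> / 4}"
    using assms by (intro eventually_at_right_real) simp
  then show ?thesis
  proof eventually_elim
    case (elim \<alpha>)
    then have \<alpha>: "0 < \<alpha>" "4 * \<alpha> \<le> \<Lambda>" by auto
    define \<epsilon> where "\<epsilon> = (1 - exp (- \<alpha>)) / 4"
    have \<epsilon>: "0 < \<epsilon>" using \<alpha> by (simp add: \<epsilon>_def)
    \<comment> \<open>By \<open>exp x \<ge> 1 + x\<close>, a linear condition on \<open>N\<close>
      suffices for \<open>N_large\<close>.\<close>
    obtain N :: nat where N: "2 * (32 / \<epsilon> + \<Lambda>) < N * \<Lambda>" using reals_Archimedean3[OF assms] by blast
    have "32 / \<epsilon> \<le> exp (\<Lambda> * N / 2 - \<Lambda>)"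
      using exp_ge_add_one_self[of "\<Lambda> * N / 2 - \<Lambda>"] N by argo
    then have N_large: "32 \<le> \<epsilon> * exp (\<Lambda> * N / 2 - \<Lambda>)" using \<epsilon> by (simp add: divide_le_eq mult.commute)
    define \<delta>\<^sub>0 where "\<delta>\<^sub>0 = min (1/10) (\<epsilon> * exp (- 2 * \<alpha> * N) / (4 ^ N * 4))"
    have "\<forall>\<^sub>F \<delta> in at_right 0. \<delta> \<in> {0<..<\<delta>\<^sub>0}"
      using \<epsilon> by (intro eventually_at_right_real) (simp add: \<delta>\<^sub>0_def)
    then show ?case
    proof eventually_elim
      case (elim \<delta>)
      then have \<delta>: "0 < \<delta>" "\<delta> \<le> 1/10" "\<delta> \<le> \<epsilon> * exp (- 2 * \<alpha> * N) / (4 ^ N * 4)"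
        by (auto simp: \<delta>\<^sub>0_def)
      \<comment> \<open>The threshold imposed on \<open>\<delta>\<close> is the one that
        \<open>delta_small\<close> needs for \<open>\<delta>\<^sup>2\<close>.\<close>
      have d2: "\<delta>\<^sup>2 \<le> \<delta>" using \<delta> by (simp add: power2_eq_square mult_left_le_one_le)
      then have "\<delta>\<^sup>2 \<le> \<epsilon> * exp (- 2 * \<alpha> * N) / (4 ^ N * 4)" using \<delta>(3) by linarith
      then have delta_small: "4 ^ N * (4 * \<delta>\<^sup>2) \<le> \<epsilon> * exp (- 2 * \<alpha> * N)"
        by (simp add: le_divide_eq mult_ac)
      have "\<forall>\<^sub>F a\<^sub>0 in at_left 2. a\<^sub>0 \<in> {2 - \<delta>\<^sup>2/2<..<2::real}"
        using \<delta> by (intro eventually_at_left_real) simp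
      then show ?case
      proof eventually_elim
        case (elim a\<^sub>0)
        show ?case
        proof (intro allI impI ballI)
          fix A P ret a
          assume bc: "benedicks_carleson \<Lambda> \<alpha> \<delta> a\<^sub>0 A P ret" and a: "a \<in> (\<Inter>n. A n)"
          interpret benedicks_carleson \<Lambda> \<alpha> \<delta> a\<^sub>0 A P ret by (rule bc)
          have a0_pos: "0 < a\<^sub>0" using elim d2 \<delta> by simp
          \<comment> \<open>The lower end of the parameter interval was taken so close to 2 that the
            uniform expansion away from 0 applies to \<open>a\<close>.\<close>
          have a_near: "2 - \<delta>\<^sup>2/2 \<le> a" "a \<le> 2" "0 < a" using a nbhd[of 0] elim a0_pos by auto
          have aA: "a \<in> A n" for n using a by blast
          interpret ce: collet_eckmann a \<Lambda> \<alpha> \<delta> \<epsilon> N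
          proof
            show "exp (- \<alpha> * Suc j) \<le> \<bar>(quad a ^^ Suc j) 0\<bar>" for j
              using slow_recurrence[OF aA, of "Suc j" "Suc j"] by simp
            show "exp (\<Lambda> * j) \<le> (\<Prod>i<j. 2 * a * \<bar>(quad a ^^ Suc i) 0\<bar>)" for j
              using growth[OF aA[of j], of j] abs_deriv_critical_value[OF a_near(3)] by simp
          qed (use \<alpha> \<delta> \<epsilon> N_large delta_small a_near in \<open>auto simp: \<epsilon>_def\<close>)
          have "0 < \<delta>\<^sup>2 / 2" using \<delta> by simp
          then have "\<forall>x\<in>{-1..1}. \<forall>y\<in>{-1..1}. same_side a x y \<longrightarrow> x = y"
            using no_homterval[OF a_near(3,2) _ ce.homterval_becomes_long] by blast
          from superstable_approximation[OF a a0_pos \<delta>(1) this]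
          show "\<exists>(as :: nat \<Rightarrow> real) (r :: nat \<Rightarrow> nat) (S :: nat \<Rightarrow> real set).
              (\<forall>n. as n \<in> {0<..2} \<and> super_stable (as n) (r n) (S n)) \<and>
              as \<longlonglongrightarrow> a \<and>
              incseq r \<and> filterlim r at_top sequentially \<and>
              (\<forall>M. acip a M \<and> generic a 0 M \<longrightarrow> weak_star_lim (\<lambda>n. orbit_measure (S n)) M)" .
        qed
      qed
    qed
  qed
qed

end
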